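(* Let $\psi\in\Psi$, $A\in\mathcal{A}\setminus\{A_M\}$, let $\tau_A$ denote Kendall's $\tau$ of the extreme-value copula $C_A$, and let $C_{\psi,A}$ be the corresponding Archimax copula with Kendall distribution function $F^K_{\psi,A}$. Then there exists a unique Archimedean copula whose Kendall distribution function coincides with $F^K_{\psi,A}$. This Archimedean copula is $C_{(\psi)_{1-\tau_A}}$, i.e. the Archimedean copula with generator $(\psi)_{1-\tau_A}$.
   Context: Write $\mathbb{I}=[0,1]$. $\Psi$ denotes the set of convex normalized (Archimedean) generators: continuous, non-increasing, convex $\psi:[0,\infty)\to\mathbb{I}$ with $\psi(0)=1$, $\lim_{z\to\infty}\psi(z)=0$, $\psi$ strictly decreasing on $[0,\inf\{x:\psi(x)=0\})$ (with $\inf\emptyset=\infty$), and $\psi(1)=\frac12$. The pseudo-inverse of $\psi$ is $\varphi:\mathbb{I}\to[0,\infty]$, $\varphi(y)=\inf\{z\in[0,\infty]:\psi(z)=y\}$ (with $\psi(\infty)=0$). An Archimedean copula is a copula of the form $C_\psi(x,y)=\psi(\varphi(x)+\varphi(y))$ with $\psi\in\Psi$. $\mathcal{A}$ denotes the set of Pickands dependence functions, i.e. convex $A:\mathbb{I}\to\mathbb{I}$ with $\max\{1-x,x\}\le A(x)\le1$ for all $x$; $A_M(t)=\max\{t,1-t\}$. The extreme-value copula of $A$ is $C_A(x,y)=(xy)^{A(\log x/\log(xy))}$ on $(0,1)^2$, extended continuously to a copula on $\mathbb{I}^2$. Kendall's $\tau$ of a copula $C$ with associated measure $\mu_C$ is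 $\tau(C)=4\int_{\mathbb{I}^2}C\,d\mu_C-1$; $\tau_A:=\tau(C_A)\in[0,1]$, and $\tau_A<1$ if $A\ne A_M$. For $\psi\in\Psi$ and $A\in\mathcal{A}$ the Archimax copula is $C_{\psi,A}(x,y)=\psi\big((\varphi(x)+\varphi(y))A\big(\frac{\varphi(x)}{\varphi(x)+\varphi(y)}\big)\big)$ on $(0,1)^2$, extended continuously to a copula on $\mathbb{I}^2$. For a copula $C$ and $(U,V)\sim C$, the Kendall distribution function is $F^K_C(t)=\mathbb{P}[C(U,V)\le t]$, $t\in\mathbb{I}$; $F^K_{\psi,A}:=F^K_{C_{\psi,A}}$. For $\alpha\in(0,1]$, $(\psi)_\alpha(z):=\psi(z^\alpha)$, which again belongs to $\Psi$. *)

theory Defs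
  imports "HOL-Probability.Probability"
begin

abbreviation unit_square :: "(real \<times> real) set" where
  "unit_square \<equiv> {0..1} \<times> {0..1}"

text \<open>Copulas are functions on the closed unit square, represented as extensional functions, so that
  equality of HOL functions is equality on the square.\<close>

definition is_copula :: "(real \<times> real \<Rightarrow> real) \<Rightarrow> bool" where
  "is_copula C \<longleftrightarrow>
     C \<in> extensional unit_square \<and>
     (\<forall>x\<in>{0..1}. C (x, 0) = 0 \<and> C (0, x) = 0 \<and> C (x, 1) = x \<and> C (1, x) = x) \<and>
     (\<forall>x1\<in>{0..1}. \<forall>x2\<in>{0..1}. \<forall>y1\<in>{0..1}. \<forall>y2\<in>{0..1}. x1 \<le> x2 \<longrightarrow> y1 \<le> y2 \<longrightarrow>
        C (x2, y2) - C (x2, y1) - C (x1, y2) + C (x1, y1) \<ge> 0)"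

text \<open>The Borel measure on the unit square whose distribution function is \<open>C\<close>. It is unique because
  the rectangles below are intersection-stable and generate the Borel sets of the square.\<close>

definition copula_measure :: "(real \<times> real \<Rightarrow> real) \<Rightarrow> (real \<times> real) measure" where
  "copula_measure C = (THE M. sets M = sets (restrict_space borel unit_square) \<and>
     (\<forall>x\<in>{0..1}. \<forall>y\<in>{0..1}. emeasure M ({0..x} \<times> {0..y}) = ennreal (C (x, y))))"

definition kendall_tau :: "(real \<times> real \<Rightarrow> real) \<Rightarrow> real" where
  "kendall_tau C = 4 * (\<integral>p. C p \<partial>copula_measure C) - 1"

definition kendall_distribution :: "(real \<times> real \<Rightarrow> real) \<Rightarrow> real \<Rightarrow> real" where
  "kendall_distribution C t = measure (copula_measure C) {p \<in> unit_square. C p \<le> t}"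

text \<open>Generators live on \<open>[0,\<infinity>)\<close>; their values at negative reals are irrelevant. The infimum of the
  zeros is taken in \<open>[0,\<infinity>]\<close>, so it is \<open>\<infinity>\<close> if there are none.\<close>

definition generators :: "(real \<Rightarrow> real) set" where
  "generators = {\<psi>.
     \<psi> \<in> {0..} \<rightarrow> {0..1} \<and> continuous_on {0..} \<psi> \<and> antimono_on {0..} \<psi> \<and> convex_on {0..} \<psi> \<and>
     \<psi> 0 = 1 \<and> (\<psi> \<longlongrightarrow> 0) at_top \<and>
     strict_antimono_on {z. 0 \<le> z \<and> ennreal z < Inf (ennreal ` {x. 0 \<le> x \<and> \<psi> x = 0})} \<psi> \<and>
     \<psi> 1 = 1 / 2}"

definition generator_ext :: "(real \<Rightarrow> real) \<Rightarrow> ennreal \<Rightarrow> real" where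
  "generator_ext \<psi> z = (if z = \<infinity> then 0 else \<psi> (enn2real z))"

definition pseudo_inverse :: "(real \<Rightarrow> real) \<Rightarrow> real \<Rightarrow> ennreal" where
  "pseudo_inverse \<psi> y = Inf {z. generator_ext \<psi> z = y}"

definition generator_power :: "(real \<Rightarrow> real) \<Rightarrow> real \<Rightarrow> real \<Rightarrow> real" where
  "generator_power \<psi> \<alpha> = (\<lambda>z. \<psi> (z powr \<alpha>))"

definition archimedean :: "(real \<Rightarrow> real) \<Rightarrow> real \<times> real \<Rightarrow> real" where
  "archimedean \<psi> = restrict
     (\<lambda>(x, y). generator_ext \<psi> (pseudo_inverse \<psi> x + pseudo_inverse \<psi> y)) unit_square"

definition archimedean_copula :: "(real \<times> real \<Rightarrow> real) \<Rightarrow> bool" where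
  "archimedean_copula C \<longleftrightarrow> is_copula C \<and> (\<exists>\<psi>\<in>generators. C = archimedean \<psi>)"

definition pickands :: "(real \<Rightarrow> real) set" where
  "pickands = {A. convex_on {0..1} A \<and> (\<forall>x\<in>{0..1}. max (1 - x) x \<le> A x \<and> A x \<le> 1)}"

definition pickands_M :: "real \<Rightarrow> real" where
  "pickands_M t = max t (1 - t)"

text \<open>Extension of a function on the open unit square to the closed one; the boundary values are those
  shared by all copulas, hence the only possible ones for a continuous extension to a copula.\<close>

definition copula_extension :: "(real \<Rightarrow> real \<Rightarrow> real) \<Rightarrow> real \<times> real \<Rightarrow> real" where
  "copula_extension f = restrict
     (\<lambda>(x, y). if x = 0 \<or> y = 0 then 0 else if x = 1 then y else if y = 1 then x else f x y)
     unit_square"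

definition extreme_value_copula :: "(real \<Rightarrow> real) \<Rightarrow> real \<times> real \<Rightarrow> real" where
  "extreme_value_copula A = copula_extension (\<lambda>x y. (x * y) powr A (ln x / ln (x * y)))"

text \<open>The pseudo-inverse of a generator is finite and positive on \<open>(0,1)\<close>, so the conversion to real
  loses nothing there.\<close>

definition archimax_copula :: "(real \<Rightarrow> real) \<Rightarrow> (real \<Rightarrow> real) \<Rightarrow> real \<times> real \<Rightarrow> real" where
  "archimax_copula \<psi> A = copula_extension (\<lambda>x y.
     let a = enn2real (pseudo_inverse \<psi> x); b = enn2real (pseudo_inverse \<psi> y)
     in \<psi> ((a + b) * A (a / (a + b))))"

end

theory Submission
  imports Defs
begin

text \<open>Write \<open>\<phi>\<close> for the inverse of \<open>\<psi>\<close> and \<open>l(x, y) = (x + y) A(x / (x + y))\<close>, a convex and homogeneous function.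
  The Archimax copula is \<open>\<psi> (l (\<phi> x, \<phi> y))\<close>, so it is the law of \<open>(\<psi> X, \<psi> Y)\<close> for any pair
  \<open>(X, Y)\<close> of positive random variables with joint survival function \<open>\<psi> \<circ> l\<close>. Such a pair can be written down:
  \<open>X\<close> has density \<open>g = - \<psi>'\<close>, and given \<open>X = x\<close>, \<open>Y\<close> exceeds \<open>y\<close> with probability
  \<open>e (y / x) g (l (x, y)) / g x\<close>, where \<open>e (y / x)\<close> is the partial derivative of \<open>l\<close> in \<open>x\<close>; by
  homogeneity it depends on \<open>y / x\<close> only. Integrating over \<open>x > a\<close> gives back \<open>\<psi> (l (a, b))\<close>. This
  simultaneously proves that the Archimax function is a copula and exhibits its measure
  (\<open>cond_kernel_nn_integral\<close>, \<open>copula_of_random_pair\<close>, \<open>archimax\<close>).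

  The value of the copula at its own random point is \<open>\<psi> (l (X, Y))\<close>, and it is below \<open>\<psi> z\<close> iff \<open>l (X, Y) > z\<close>.
  Either \<open>X > z\<close>, which has probability \<open>\<psi> z\<close>, or \<open>X = x \<le> z\<close> and \<open>Y\<close> lies beyond the level curve \<open>l = z\<close>.
  On that curve the factor \<open>g (l (x, y))\<close> is the constant \<open>g z\<close>, while by homogeneity the slopes \<open>e\<close>
  integrate to \<open>\<kappa> z\<close> with a number \<open>\<kappa>\<close> that depends on \<open>A\<close> only. Hence
  \<open>P (C < \<psi> z) = \<psi> z + \<kappa> z g z\<close> (\<open>kendall_strict_archimax\<close>), and everything else is read off from
  this formula:

  \<^item> For \<open>\<psi> z = 2 powr - z\<close> the copula is the extreme-value copula of \<open>A\<close>, and integrating the formula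
    gives \<open>\<kappa> = 1 - \<tau>\<close> (\<open>kendall_tau_extreme_value\<close>). If \<open>\<kappa> = 0\<close>, the slopes vanish along the level curve,
    which forces \<open>l = max\<close> and \<open>A = pickands_M\<close> (\<open>kendall_slope_pos\<close>).
  \<^item> For \<open>A = 1\<close> the copula is Archimedean and \<open>\<kappa> = 1\<close>. Passing from \<open>\<psi>\<close> to \<open>\<psi> (z powr \<alpha>)\<close> multiplies
    \<open>z g z\<close> by \<open>\<alpha>\<close> at corresponding points, so \<open>\<alpha> = \<kappa>\<close> yields the required Archimedean copula
    (\<open>kendall_strict_generator_power\<close>).
  \<^item> The Kendall distribution of an Archimedean copula determines \<open>\<phi> g(\<phi>)\<close>, hence the derivative
    \<open>- 1 / (\<phi> g(\<phi>))\<close> of \<open>ln \<phi>\<close>; the normalization \<open>\<psi> 1 = 1 / 2\<close> fixes the constant (\<open>generator_inv_unique\<close>).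

  Neither \<open>\<psi>\<close> nor \<open>A\<close> need be differentiable. Right derivatives of convex functions exist everywhere
  and are monotone and right-continuous, and this is enough: wherever a derivative would be integrated, the
  increments and the integral are squeezed between the same monotone bounds (\<open>squeezed_integral\<close>).\<close>

section \<open>Right derivatives of convex functions\<close>

text \<open>The right derivative of a convex function. As an infimum of chord slopes it is defined without any
  convergence argument.\<close>

definition right_slope :: "(real \<Rightarrow> real) \<Rightarrow> real \<Rightarrow> real" where
  "right_slope F x = (INF t\<in>{x<..}. (F t - F x) / (t - x))"

lemma convex_chord_slopes:
  fixes F :: "real \<Rightarrow> real"
  assumes "convex_on {c<..} F" "c < x" "x < t" "t < y"
  shows "(F t - F x) / (t - x) \<le> (F y - F x) / (y - x)"
    and "(F y - F x) / (y - x) \<le> (F y - F t) / (y - t)"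
proof -
  have swap: "(u - v) / (p - q) = (v - u) / (q - p)" for u v p q :: real
    by (metis minus_diff_eq minus_divide_divide)
  note convex_on_slope_le[OF assms(1), of x y t]
  hence "(F x - F t) / (x - t) \<le> (F x - F y) / (x - y)"
    and "(F x - F y) / (x - y) \<le> (F t - F y) / (t - y)"
    using assms by auto
  thus "(F t - F x) / (t - x) \<le> (F y - F x) / (y - x)"
    and "(F y - F x) / (y - x) \<le> (F y - F t) / (y - t)"
    unfolding swap[of "F x"] swap[of "F t" "F y"] by auto
qed

lemma right_slope_bounds:
  fixes F :: "real \<Rightarrow> real"
  assumes cv: "convex_on {c<..} F" and "c < x" "x < y"
  shows right_slope_le_chord: "right_slope F x \<le> (F y - F x) / (y - x)"
    and chord_le_right_slope: "(F y - F x) / (y - x) \<le> right_slope F y"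
    and bdd_below_chord_slopes: "bdd_below ((\<lambda>t. (F t - F x) / (t - x)) ` {x<..})"
proof -
  have *: "(F v - F u) / (v - u) \<le> (F t - F v) / (t - v)" if "c < u" "u < v" "v < t" for u v t
    using convex_chord_slopes[OF cv that] by linarith
  have bdd: "bdd_below ((\<lambda>t. (F t - F v) / (t - v)) ` {v<..})" if "c < v" for v
  proof (rule bdd_belowI2)
    fix t assume "t \<in> {v<..}"
    thus "(F v - F ((c + v) / 2)) / (v - (c + v) / 2) \<le> (F t - F v) / (t - v)"
      using *[of "(c + v) / 2" v t] that by simp
  qed
  show "bdd_below ((\<lambda>t. (F t - F x) / (t - x)) ` {x<..})"
    using bdd assms by simp
  show "right_slope F x \<le> (F y - F x) / (y - x)"
    unfolding right_slope_def using assms by (intro cINF_lower bdd) auto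
  show "(F y - F x) / (y - x) \<le> right_slope F y"
    unfolding right_slope_def using assms * by (intro cINF_greatest) auto
qed

lemma convex_increment_bounds:
  fixes F :: "real \<Rightarrow> real"
  assumes cv: "convex_on {c<..} F" and "c < x" "x \<le> y"
  shows "right_slope F x * (y - x) \<le> F y - F x"
    and "F y - F x \<le> right_slope F y * (y - x)"
  using right_slope_bounds(1,2)[OF cv, of x y] assms
  by (cases "x = y"; simp add: field_simps)+

lemma right_slope_mono:
  fixes F :: "real \<Rightarrow> real"
  assumes cv: "convex_on {c<..} F"
  shows "mono_on {c<..} (right_slope F)"
proof (rule mono_onI)
  fix x y :: real assume "x \<in> {c<..}" "y \<in> {c<..}" "x \<le> y"
  thus "right_slope F x \<le> right_slope F y"
    using right_slope_bounds(1,2)[OF cv, of x y] by (cases "x = y") auto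
qed

lemma right_slope_tendsto:
  fixes F :: "real \<Rightarrow> real"
  assumes cv: "convex_on {c<..} F" and "c < x"
  shows "((\<lambda>t. (F t - F x) / (t - x)) \<longlongrightarrow> right_slope F x) (at_right x)"
proof (rule order_tendstoI)
  fix a assume "a < right_slope F x"
  thus "eventually (\<lambda>t. a < (F t - F x) / (t - x)) (at_right x)"
    using right_slope_bounds(1)[OF cv \<open>c < x\<close>]
    by (intro eventually_at_rightI[of x "x + 1"]) (auto intro: less_le_trans)
next
  fix a assume "right_slope F x < a"
  then obtain y where y: "x < y" "(F y - F x) / (y - x) < a"
    using cINF_less_iff[OF _ bdd_below_chord_slopes[OF cv \<open>c < x\<close>, of "x + 1"]]
    unfolding right_slope_def by auto
  show "eventually (\<lambda>t. (F t - F x) / (t - x) < a) (at_right x)"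
    using convex_chord_slopes(1)[OF cv \<open>c < x\<close>] y
    by (intro eventually_at_rightI[of x y]) (auto intro: le_less_trans)
qed

text \<open>A chord slope \<open>(F y - F t) / (y - t)\<close> with fixed \<open>y\<close> is continuous in \<open>t\<close> and bounds the
  right derivative at \<open>t\<close> from above; taking \<open>y\<close> close to \<open>x\<close> gives the upper estimate, monotonicity the lower one.\<close>

lemma right_slope_continuous_at_right:
  fixes F :: "real \<Rightarrow> real"
  assumes cv: "convex_on {c<..} F" and "c < x"
  shows "(right_slope F \<longlongrightarrow> right_slope F x) (at_right x)"
proof (rule order_tendstoI)
  fix a assume "a < right_slope F x"
  thus "eventually (\<lambda>t. a < right_slope F t) (at_right x)"
    using mono_onD[OF right_slope_mono[OF cv], of x] \<open>c < x\<close>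
    by (intro eventually_at_rightI[of x "x + 1"]) (auto intro: less_le_trans)
next
  fix a assume "right_slope F x < a"
  then obtain y where y: "x < y" "(F y - F x) / (y - x) < a"
    using cINF_less_iff[OF _ bdd_below_chord_slopes[OF cv \<open>c < x\<close>, of "x + 1"]]
    unfolding right_slope_def by auto
  have "isCont F x"
    using convex_on_continuous[OF open_greaterThan cv] \<open>c < x\<close>
    by (auto simp: continuous_on_eq_continuous_at[OF open_greaterThan])
  hence lim: "(F \<longlongrightarrow> F x) (at_right x)"
    unfolding isCont_def by (rule filterlim_mono) (auto intro: at_le)
  have "((\<lambda>t. (F y - F t) / (y - t)) \<longlongrightarrow> (F y - F x) / (y - x)) (at_right x)"
    using y(1) by (intro tendsto_intros lim) auto
  hence "eventually (\<lambda>t. (F y - F t) / (y - t) < a) (at_right x)"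
    using y(2) by (rule order_tendstoD)
  moreover have "eventually (\<lambda>t. t \<in> {x<..<y}) (at_right x)"
    using y(1) by (rule eventually_at_right_real)
  ultimately show "eventually (\<lambda>t. right_slope F t < a) (at_right x)"
  proof eventually_elim
    case (elim t)
    thus ?case using right_slope_bounds(1)[OF cv, of t y] \<open>c < x\<close> by simp
  qed
qed

lemma right_slope_eqI:
  fixes F :: "real \<Rightarrow> real"
  assumes "convex_on {c<..} F" "c < x" "((\<lambda>t. (F t - F x) / (t - x)) \<longlongrightarrow> D) (at_right x)"
  shows "right_slope F x = D"
  using right_slope_tendsto[OF assms(1,2)] assms(3) tendsto_unique[OF trivial_limit_at_right_real] by blast

lemma DERIV_tendsto_at_right:
  fixes F :: "real \<Rightarrow> real"
  assumes "(F has_real_derivative D) (at x)"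
  shows "((\<lambda>t. (F t - F x) / (t - x)) \<longlongrightarrow> D) (at_right x)"
proof -
  have "((\<lambda>t. (F t - F x) / (t - x)) \<longlongrightarrow> D) (at x)"
    using assms by (simp add: has_field_derivative_iff)
  thus ?thesis by (rule filterlim_mono) (auto intro: at_le)
qed

lemma borel_measurable_if_mono_on:
  fixes f :: "real \<Rightarrow> real"
  assumes "mono_on {c<..} f"
  shows "(\<lambda>x. if c < x then f x else d) \<in> borel_measurable borel"
  using borel_measurable_mono_on_fnc[OF assms]
  by (subst measurable_If_restrict_space_iff) (auto simp: greaterThan_def)

section \<open>Integration by squeezing\<close>

text \<open>Cut the interval into \<open>n\<close> equal pieces: the increments of \<open>B\<close> telescope, so the total
  increment of \<open>D\<close> is \<open>O(1/n)\<close>.\<close>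

lemma constant_if_increments_small:
  fixes D B :: "real \<Rightarrow> real"
  assumes "a \<le> b"
    and inc: "\<And>x y. a \<le> x \<Longrightarrow> x \<le> y \<Longrightarrow> y \<le> b \<Longrightarrow> \<bar>D y - D x\<bar> \<le> (y - x) * (B y - B x)"
  shows "D b = D a"
proof -
  have bound: "\<bar>D b - D a\<bar> \<le> (b - a) / real n * (B b - B a)" if n: "n > 0" for n :: nat
  proof -
    define p where "p i = a + real i * ((b - a) / real n)" for i
    have p0: "p 0 = a" "p n = b" using n by (auto simp: p_def)
    have step: "p (Suc i) - p i = (b - a) / real n" for i
      by (simp add: p_def algebra_simps add_divide_distrib[symmetric] diff_divide_distrib[symmetric])
    have pos: "0 \<le> (b - a) / real n" using \<open>a \<le> b\<close> by simp
    have "p i \<le> p j" if "i \<le> j" for i j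
      using that pos unfolding p_def by (intro add_left_mono mult_right_mono) auto
    hence "\<bar>D (p (Suc i)) - D (p i)\<bar> \<le> (b - a) / real n * (B (p (Suc i)) - B (p i))" if "i < n" for i
      using inc[of "p i" "p (Suc i)"] that p0 step[of i]
      by (metis Suc_leI le_SucI le_refl zero_le)
    hence "(\<Sum>i<n. \<bar>D (p (Suc i)) - D (p i)\<bar>) \<le> (\<Sum>i<n. (b - a) / real n * (B (p (Suc i)) - B (p i)))"
      by (intro sum_mono) auto
    also have "\<dots> = (b - a) / real n * (B b - B a)"
      using sum_lessThan_telescope[of "\<lambda>i. B (p i)" n] p0
      unfolding sum_distrib_left[symmetric] by simp
    finally have "(\<Sum>i<n. \<bar>D (p (Suc i)) - D (p i)\<bar>) \<le> (b - a) / real n * (B b - B a)" .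
    moreover have "\<bar>D b - D a\<bar> = \<bar>\<Sum>i<n. D (p (Suc i)) - D (p i)\<bar>"
      using sum_lessThan_telescope[of "\<lambda>i. D (p i)" n] p0 by simp
    moreover have "\<dots> \<le> (\<Sum>i<n. \<bar>D (p (Suc i)) - D (p i)\<bar>)" by (rule sum_abs)
    ultimately show ?thesis by linarith
  qed
  have "(\<lambda>n. (b - a) / real n * (B b - B a)) \<longlonglongrightarrow> 0"
    by (intro tendsto_mult_left_zero lim_const_over_n)
  hence "\<bar>D b - D a\<bar> \<le> 0"
    by (rule LIMSEQ_le_const) (use bound in \<open>auto intro!: exI[of _ 1]\<close>)
  thus ?thesis by simp
qed

text \<open>A fundamental theorem of calculus without derivatives: the increments of \<open>F\<close> and the integrals of \<open>k\<close>
  obey the same bounds, and the gap between the bounds is controlled by increments of \<open>B\<close>. It serves for integrands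
  that are products of monotone functions, where \<open>F\<close> may fail to be differentiable at infinitely many points.\<close>

lemma squeezed_integral:
  fixes F k B :: "real \<Rightarrow> real" and lo hi :: "real \<Rightarrow> real \<Rightarrow> real"
  assumes "a \<le> b" and int: "k integrable_on {a..b}"
    and F: "\<And>x y. a \<le> x \<Longrightarrow> x \<le> y \<Longrightarrow> y \<le> b \<Longrightarrow>
              lo x y * (y - x) \<le> F y - F x \<and> F y - F x \<le> hi x y * (y - x)"
    and k: "\<And>x s y. a \<le> x \<Longrightarrow> x \<le> s \<Longrightarrow> s \<le> y \<Longrightarrow> y \<le> b \<Longrightarrow> lo x y \<le> k s \<and> k s \<le> hi x y"
    and B: "\<And>x y. a \<le> x \<Longrightarrow> x \<le> y \<Longrightarrow> y \<le> b \<Longrightarrow> hi x y - lo x y \<le> B y - B x"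
  shows "(k has_integral F b - F a) {a..b}"
proof -
  define D where "D x = F x - integral {a..x} k" for x
  have "D b = D a"
  proof (rule constant_if_increments_small[where B = B, OF \<open>a \<le> b\<close>])
    fix x y assume xy: "a \<le> x" "x \<le> y" "y \<le> b"
    have i: "k integrable_on {a..y}" "k integrable_on {x..y}"
      using xy by (auto intro: integrable_subinterval_real[OF int])
    have split: "integral {a..y} k - integral {a..x} k = integral {x..y} k"
      using Henstock_Kurzweil_Integration.integral_combine[OF xy(1,2) i(1)] by simp
    have "integral {x..y} (\<lambda>_. lo x y) \<le> integral {x..y} k"
      using i k xy by (intro integral_le) auto
    moreover have "integral {x..y} k \<le> integral {x..y} (\<lambda>_. hi x y)"
      using i k xy by (intro integral_le) auto
    ultimately have "\<bar>D y - D x\<bar> \<le> (y - x) * (hi x y - lo x y)"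
      using F[OF xy] split xy(2) by (auto simp: D_def algebra_simps)
    also have "\<dots> \<le> (y - x) * (B y - B x)"
      using B[OF xy] xy by (intro mult_left_mono) auto
    finally show "\<bar>D y - D x\<bar> \<le> (y - x) * (B y - B x)" .
  qed
  hence "integral {a..b} k = F b - F a" by (simp add: D_def)
  thus ?thesis using int by (metis integrable_integral)
qed

section \<open>The stable tail dependence function\<close>

text \<open>The homogeneous extension of \<open>A\<close>, known as the stable tail dependence function of the extreme-value
  copula of \<open>A\<close>.\<close>

definition stdf :: "(real \<Rightarrow> real) \<Rightarrow> real \<Rightarrow> real \<Rightarrow> real" where
  "stdf A x y = (x + y) * A (x / (x + y))"

text \<open>The constant continuation to negative arguments keeps the function convex and makes \<open>0\<close> an interior
  point of its domain.\<close>

definition stdf_section :: "(real \<Rightarrow> real) \<Rightarrow> real \<Rightarrow> real" where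
  "stdf_section A r = stdf A 1 (max r 0)"

text \<open>Since \<open>stdf A x y = x * stdf_section A (y / x)\<close>, this is the left partial derivative of \<open>stdf A\<close>
  in \<open>x\<close>, as a function of \<open>y / x\<close>. Geometrically it is the intercept at \<open>0\<close> of the right tangent to
  \<open>stdf_section A\<close>.\<close>

definition stdf_slope :: "(real \<Rightarrow> real) \<Rightarrow> real \<Rightarrow> real" where
  "stdf_slope A r = stdf_section A r - r * right_slope (stdf_section A) r"

text \<open>For \<open>0 < x \<le> z\<close> the level set \<open>{stdf A \<le> z}\<close> reaches above \<open>x\<close> exactly up to the height
  \<open>x * level_ratio A (z / x)\<close>.\<close>

definition level_ratio :: "(real \<Rightarrow> real) \<Rightarrow> real \<Rightarrow> real" where
  "level_ratio A s = Sup {r. 0 \<le> r \<and> stdf_section A r \<le> s}"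

text \<open>The slope \<open>stdf_slope A\<close> along the level curve \<open>stdf A = 1\<close>, parametrized by the first coordinate.
  The value \<open>0\<close> for negative arguments keeps the function monotone.\<close>

definition level_slope :: "(real \<Rightarrow> real) \<Rightarrow> real \<Rightarrow> real" where
  "level_slope A x = (if x > 0 then stdf_slope A (level_ratio A (1 / x)) else 0)"

text \<open>This is the constant \<open>\<kappa>\<close> that turns out to be \<open>1 - \<tau>\<close>.\<close>

definition kendall_slope :: "(real \<Rightarrow> real) \<Rightarrow> real" where
  "kendall_slope A = integral {0..1} (level_slope A)"

context
  fixes A :: "real \<Rightarrow> real"
  assumes A: "A \<in> pickands"
begin

lemma stdf_bounds:
  assumes "0 \<le> x" "0 \<le> y"
  shows "x \<le> stdf A x y" "y \<le> stdf A x y" "stdf A x y \<le> x + y"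
proof -
  have "x \<le> stdf A x y \<and> y \<le> stdf A x y \<and> stdf A x y \<le> x + y"
  proof (cases "x + y = 0")
    case True
    thus ?thesis using assms by (auto simp: stdf_def)
  next
    case False
    hence pos: "x + y > 0" using assms by auto
    have "x / (x + y) \<in> {0..1}" using assms pos by auto
    hence *: "max (1 - x / (x + y)) (x / (x + y)) \<le> A (x / (x + y))" "A (x / (x + y)) \<le> 1"
      using A by (auto simp: pickands_def)
    have "(x + y) * (1 - x / (x + y)) \<le> stdf A x y" "(x + y) * (x / (x + y)) \<le> stdf A x y"
      "stdf A x y \<le> (x + y) * 1"
      unfolding stdf_def using * pos by (intro mult_left_mono; simp)+
    moreover have "(x + y) * (1 - x / (x + y)) = y" "(x + y) * (x / (x + y)) = x"
      using pos by (auto simp: field_simps)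
    ultimately show ?thesis by auto
  qed
  thus "x \<le> stdf A x y" "y \<le> stdf A x y" "stdf A x y \<le> x + y" by auto
qed

lemma stdf_0 [simp]: "0 \<le> x \<Longrightarrow> stdf A x 0 = x" "0 \<le> y \<Longrightarrow> stdf A 0 y = y"
  using stdf_bounds[of x 0] stdf_bounds[of 0 y] by auto

lemma stdf_scale: "stdf A (c * x) (c * y) = c * stdf A x y"
  by (cases "c = 0") (auto simp: stdf_def distrib_left[symmetric])

text \<open>Convexity of \<open>A\<close> at the two points \<open>x / (x + y)\<close> and \<open>x' / (x' + y')\<close>, with weights proportional
  to the sums \<open>x + y\<close> and \<open>x' + y'\<close>.\<close>

lemma stdf_subadditive:
  assumes "0 \<le> x" "0 \<le> y" "0 \<le> x'" "0 \<le> y'"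
  shows "stdf A (x + x') (y + y') \<le> stdf A x y + stdf A x' y'"
proof (cases "x + y = 0 \<or> x' + y' = 0")
  case True
  thus ?thesis using assms by (auto simp: add_nonneg_eq_0_iff)
next
  case False
  define s s' where "s = x + y" and "s' = x' + y'"
  define t where "t = s' / (s + s')"
  have pos: "s > 0" "s' > 0" using False assms by (auto simp: s_def s'_def)
  have t: "0 \<le> t" "t \<le> 1" "1 - t = s / (s + s')" using pos by (auto simp: t_def field_simps)
  have mem: "x / s \<in> {0..1}" "x' / s' \<in> {0..1}"
    using assms pos by (auto simp: s_def s'_def)
  have "A ((1 - t) *\<^sub>R (x / s) + t *\<^sub>R (x' / s')) \<le> (1 - t) * A (x / s) + t * A (x' / s')"
    using A t mem by (intro convex_onD) (auto simp: pickands_def)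
  moreover have "(1 - t) *\<^sub>R (x / s) + t *\<^sub>R (x' / s') = (x + x') / (s + s')"
    unfolding t(3) using pos by (simp add: t_def add_divide_distrib)
  ultimately have "(s + s') * A ((x + x') / (s + s')) \<le> (s + s') * ((1 - t) * A (x / s) + t * A (x' / s'))"
    using pos by (intro mult_left_mono) auto
  also have "\<dots> = s * A (x / s) + s' * A (x' / s')"
    unfolding t(3) using pos by (simp add: t_def distrib_left)
  finally show ?thesis by (simp add: stdf_def s_def s'_def algebra_simps)
qed

lemma stdf_convex:
  assumes "0 \<le> x" "0 \<le> y" "0 \<le> x'" "0 \<le> y'" "0 \<le> t" "t \<le> 1"
  shows "stdf A ((1 - t) * x + t * x') ((1 - t) * y + t * y') \<le> (1 - t) * stdf A x y + t * stdf A x' y'"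
  using stdf_subadditive[of "(1 - t) * x" "(1 - t) * y" "t * x'" "t * y'"] assms
  by (simp add: stdf_scale)

text \<open>On a horizontal line the convex function \<open>stdf A\<close> attains its minimum \<open>y\<close> at \<open>x = 0\<close>, and likewise
  on a vertical line.\<close>

lemma stdf_mono:
  assumes "0 \<le> x" "x \<le> x'" "0 \<le> y" "y \<le> y'"
  shows "stdf A x y \<le> stdf A x' y'"
proof -
  have "stdf A x y \<le> stdf A x' y"
  proof (cases "x' = 0")
    case False
    hence x': "x' > 0" using assms by auto
    define t where "t = x / x'"
    have t: "0 \<le> t" "t \<le> 1" "x = t * x'" using x' assms by (auto simp: t_def)
    have "stdf A ((1 - t) * 0 + t * x') ((1 - t) * y + t * y) \<le> (1 - t) * stdf A 0 y + t * stdf A x' y"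
      using assms t x' by (intro stdf_convex) auto
    also have "\<dots> \<le> (1 - t) * stdf A x' y + t * stdf A x' y"
      using stdf_bounds(2)[of x' y] assms t x' by (intro add_right_mono mult_left_mono) auto
    finally show ?thesis using t(3) by (simp add: algebra_simps)
  qed (use assms in auto)
  also have "stdf A x' y \<le> stdf A x' y'"
  proof (cases "y' = 0")
    case False
    hence y': "y' > 0" using assms by auto
    define t where "t = y / y'"
    have t: "0 \<le> t" "t \<le> 1" "y = t * y'" using y' assms by (auto simp: t_def)
    have "stdf A ((1 - t) * x' + t * x') ((1 - t) * 0 + t * y') \<le> (1 - t) * stdf A x' 0 + t * stdf A x' y'"
      using assms t y' by (intro stdf_convex) auto
    also have "\<dots> \<le> (1 - t) * stdf A x' y' + t * stdf A x' y'"
      using stdf_bounds(1)[of x' y'] assms t y' by (intro add_right_mono mult_left_mono) auto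
    finally show ?thesis using t(3) by (simp add: algebra_simps)
  qed (use assms in auto)
  finally show ?thesis .
qed

lemma stdf_lipschitz:
  assumes "0 \<le> x" "x \<le> x'" "0 \<le> y" "y \<le> y'"
  shows "stdf A x' y' \<le> stdf A x y + (x' - x) + (y' - y)"
  using stdf_subadditive[of x y "x' - x" "y' - y"] stdf_bounds(3)[of "x' - x" "y' - y"] assms by auto

lemma stdf_tendsto:
  assumes "0 \<le> x" "0 \<le> y" "(u \<longlongrightarrow> x) F" "(v \<longlongrightarrow> y) F"
    and "eventually (\<lambda>i. 0 \<le> u i \<and> 0 \<le> v i) F"
  shows "((\<lambda>i. stdf A (u i) (v i)) \<longlongrightarrow> stdf A x y) F"
proof (rule Lim_null_comparison[THEN Lim_null[THEN iffD2]])
  have *: "\<bar>stdf A a b - stdf A x y\<bar> \<le> \<bar>a - x\<bar> + \<bar>b - y\<bar>" if "0 \<le> a" "0 \<le> b" for a b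
  proof -
    have "stdf A a b \<le> stdf A (max a x) (max b y)" "stdf A x y \<le> stdf A (max a x) (max b y)"
      using assms that by (auto intro!: stdf_mono)
    moreover have "stdf A (max a x) (max b y) \<le> stdf A a b + (max a x - a) + (max b y - b)"
      "stdf A (max a x) (max b y) \<le> stdf A x y + (max a x - x) + (max b y - y)"
      using assms that by (auto intro!: stdf_lipschitz)
    ultimately show ?thesis by (auto simp: max_def split: if_splits)
  qed
  show "eventually (\<lambda>i. norm (stdf A (u i) (v i) - stdf A x y) \<le> \<bar>u i - x\<bar> + \<bar>v i - y\<bar>) F"
    using assms(5) by eventually_elim (use * in auto)
  show "((\<lambda>i. \<bar>u i - x\<bar> + \<bar>v i - y\<bar>) \<longlongrightarrow> 0) F"
    using assms(3,4) by (auto intro!: tendsto_eq_intros)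
qed

lemma stdf_eq_section: "0 < x \<Longrightarrow> 0 \<le> y \<Longrightarrow> stdf A x y = x * stdf_section A (y / x)"
  using stdf_scale[of x 1 "y / x"] by (simp add: stdf_section_def max_absorb1)

lemma section_bounds:
  assumes "0 \<le> r"
  shows "1 \<le> stdf_section A r" "r \<le> stdf_section A r" "stdf_section A r \<le> 1 + r"
  using stdf_bounds[of 1 r] assms by (auto simp: stdf_section_def max_def)

lemma section_nonpos [simp]: "r \<le> 0 \<Longrightarrow> stdf_section A r = 1"
  by (simp add: stdf_section_def max_def)

lemma section_mono: "r \<le> s \<Longrightarrow> stdf_section A r \<le> stdf_section A s"
  unfolding stdf_section_def by (intro stdf_mono) auto

lemma section_convex: "convex_on {-1<..} (stdf_section A)"
proof (rule convex_onI)
  fix t x y :: real assume t: "0 < t" "t < 1"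
  have "max ((1 - t) * x + t * y) 0 \<le> (1 - t) * max x 0 + t * max y 0"
    using t by (intro max.boundedI add_mono mult_left_mono add_nonneg_nonneg mult_nonneg_nonneg) auto
  hence "stdf_section A ((1 - t) * x + t * y) \<le> stdf A 1 ((1 - t) * max x 0 + t * max y 0)"
    unfolding stdf_section_def by (intro stdf_mono) auto
  also have "\<dots> \<le> (1 - t) * stdf_section A x + t * stdf_section A y"
    using stdf_convex[of 1 "max x 0" 1 "max y 0" t] t by (simp add: stdf_section_def)
  finally show "stdf_section A ((1 - t) *\<^sub>R x + t *\<^sub>R y) \<le> (1 - t) * stdf_section A x + t * stdf_section A y"
    by simp
qed simp

lemma section_continuous: "continuous_on UNIV (stdf_section A)"
  unfolding continuous_on_def stdf_section_def by (auto intro!: stdf_tendsto tendsto_intros)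

lemma section_tangent:
  assumes "0 \<le> r" "0 \<le> t"
  shows "stdf_section A r + right_slope (stdf_section A) r * (t - r) \<le> stdf_section A t"
  using convex_increment_bounds[OF section_convex, of r t] convex_increment_bounds[OF section_convex, of t r] assms
  by (cases "r \<le> t") (auto simp: algebra_simps)

text \<open>A slope above \<open>1\<close> would contradict the linear bound \<open>stdf_section A r \<le> 1 + r\<close> for large \<open>r\<close>.\<close>

lemma section_slope_bounds:
  assumes "0 \<le> r"
  shows "0 \<le> right_slope (stdf_section A) r" "right_slope (stdf_section A) r \<le> 1"
proof -
  show "0 \<le> right_slope (stdf_section A) r"
    unfolding right_slope_def using section_mono by (intro cINF_greatest) auto
  show "right_slope (stdf_section A) r \<le> 1"
  proof (rule ccontr)
    define m where "m = right_slope (stdf_section A) r"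
    assume "\<not> ?thesis"
    hence m: "m > 1" by (simp add: m_def)
    \<comment> \<open>Any distance with \<open>(m - 1) * h > 1\<close> would do.\<close>
    define h where "h = 2 / (m - 1)"
    have "(m - 1) * h = 2"
      unfolding h_def times_divide_eq_right using m by (intro nonzero_mult_div_cancel_left) simp
    hence h: "m * h - h = 2" by (simp add: left_diff_distrib)
    have "0 \<le> h" using m by (simp add: h_def)
    note h = this h
    have "stdf_section A r + m * (r + h - r) \<le> stdf_section A (r + h)"
      unfolding m_def using assms h by (intro section_tangent) auto
    also have "\<dots> \<le> 1 + (r + h)" using assms h by (intro section_bounds) auto
    finally have "stdf_section A r + (m * h - h) \<le> 1 + r" by simp
    hence "stdf_section A r + 2 \<le> 1 + r" unfolding h .
    thus False using section_bounds[OF assms] m by simp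
  qed
qed

lemma stdf_slope_0 [simp]: "stdf_slope A 0 = 1"
  by (simp add: stdf_slope_def)

lemma stdf_slope_antimono: "antimono_on {0..} (stdf_slope A)"
proof (rule monotone_onI)
  fix r s :: real assume rs: "r \<in> {0..}" "s \<in> {0..}" "r \<le> s"
  let ?m = "right_slope (stdf_section A)"
  have "stdf_section A s + ?m s * (r - s) \<le> stdf_section A r"
    using rs by (intro section_tangent) auto
  moreover have "r * ?m r \<le> r * ?m s"
    using mono_onD[OF right_slope_mono[OF section_convex], of r s] rs by (intro mult_left_mono) auto
  ultimately show "stdf_slope A s \<le> stdf_slope A r"
    by (simp add: stdf_slope_def algebra_simps)
qed

lemma stdf_slope_bounds:
  assumes "0 \<le> r"
  shows "0 \<le> stdf_slope A r" "stdf_slope A r \<le> 1"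
proof -
  show "stdf_slope A r \<le> 1"
    using monotone_onD[OF stdf_slope_antimono, of 0 r] assms by simp
  have "r * right_slope (stdf_section A) r \<le> r * 1"
    using section_slope_bounds[OF assms] assms by (intro mult_left_mono) auto
  thus "0 \<le> stdf_slope A r"
    using section_bounds(2)[OF assms] by (simp add: stdf_slope_def)
qed

lemma stdf_slope_continuous_at_right:
  assumes "0 \<le> r"
  shows "(stdf_slope A \<longlongrightarrow> stdf_slope A r) (at_right r)"
proof -
  have "(stdf_section A \<longlongrightarrow> stdf_section A r) (at_right r)"
    using section_continuous by (auto simp: continuous_on_def intro: tendsto_within_subset)
  thus ?thesis
    unfolding stdf_slope_def[abs_def]
    using right_slope_continuous_at_right[OF section_convex, of r] assms
    by (intro tendsto_intros) auto
qed

text \<open>Tangents to \<open>stdf_section A\<close> at \<open>y / x\<close> and at \<open>y / x'\<close>, multiplied by \<open>x'\<close> and \<open>x\<close>.\<close>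

lemma stdf_increment_bounds:
  assumes "0 < x" "x \<le> x'" "0 \<le> y"
  shows "stdf_slope A (y / x) * (x' - x) \<le> stdf A x' y - stdf A x y"
    and "stdf A x' y - stdf A x y \<le> stdf_slope A (y / x') * (x' - x)"
proof -
  let ?m = "right_slope (stdf_section A)"
  have eq: "stdf A x' y = x' * stdf_section A (y / x')" "stdf A x y = x * stdf_section A (y / x)"
    using assms by (auto intro: stdf_eq_section)
  have "x' * (stdf_section A (y / x) + ?m (y / x) * (y / x' - y / x)) \<le> x' * stdf_section A (y / x')"
    using assms by (intro mult_left_mono section_tangent) auto
  moreover have "x' * (stdf_section A (y / x) + ?m (y / x) * (y / x' - y / x)) - x * stdf_section A (y / x)
    = stdf_slope A (y / x) * (x' - x)"
    using assms by (simp add: stdf_slope_def field_simps)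
  ultimately show "stdf_slope A (y / x) * (x' - x) \<le> stdf A x' y - stdf A x y" using eq by linarith
  have "x * (stdf_section A (y / x') + ?m (y / x') * (y / x - y / x')) \<le> x * stdf_section A (y / x)"
    using assms by (intro mult_left_mono section_tangent) auto
  moreover have "x' * stdf_section A (y / x') - x * (stdf_section A (y / x') + ?m (y / x') * (y / x - y / x'))
    = stdf_slope A (y / x') * (x' - x)"
    using assms by (simp add: stdf_slope_def field_simps)
  ultimately show "stdf A x' y - stdf A x y \<le> stdf_slope A (y / x') * (x' - x)" using eq by linarith
qed

lemma level_ratio:
  assumes "1 \<le> s"
  shows level_ratio_nonneg: "0 \<le> level_ratio A s"
    and section_level_ratio: "stdf_section A (level_ratio A s) = s"
    and section_le_iff: "0 \<le> r \<Longrightarrow> stdf_section A r \<le> s \<longleftrightarrow> r \<le> level_ratio A s"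
proof -
  let ?S = "{r. 0 \<le> r \<and> stdf_section A r \<le> s}"
  have bdd: "bdd_above ?S" using section_bounds(2) by (intro bdd_aboveI[of _ s]) force
  have ne: "0 \<in> ?S" using assms by simp
  have "closed ({0..} \<inter> {r. stdf_section A r \<le> s})"
    by (intro closed_Int closed_atLeast closed_Collect_le continuous_on_const section_continuous)
  hence "closed ?S" by (simp add: Collect_conj_eq atLeast_def)
  hence mem: "level_ratio A s \<in> ?S"
    unfolding level_ratio_def using bdd ne by (intro closed_contains_Sup) auto
  show nonneg: "0 \<le> level_ratio A s" using mem by simp
  show iff: "stdf_section A r \<le> s \<longleftrightarrow> r \<le> level_ratio A s" if "0 \<le> r" for r
    using that mem cSup_upper[OF _ bdd, of r] section_mono[of r "level_ratio A s"]
    by (auto simp: level_ratio_def)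
  obtain r where r: "0 \<le> r" "r \<le> s" "stdf_section A r = s"
    using IVT'[of "stdf_section A" 0 s s] assms section_bounds(2)[of s]
      continuous_on_subset[OF section_continuous, of "{0..s}"] by auto
  hence "r \<le> level_ratio A s" using iff by auto
  hence "s \<le> stdf_section A (level_ratio A s)" using section_mono r by metis
  thus "stdf_section A (level_ratio A s) = s" using mem by simp
qed

lemma level_ratio_mono:
  assumes "1 \<le> s" "s \<le> s'"
  shows "level_ratio A s \<le> level_ratio A s'"
  using assms section_le_iff[of s' "level_ratio A s"] section_level_ratio[of s] level_ratio_nonneg[of s] by simp

lemma level_slope_bounds:
  assumes "x \<le> 1"
  shows "0 \<le> level_slope A x" "level_slope A x \<le> 1"
  using assms stdf_slope_bounds level_ratio_nonneg[of "1 / x"] by (auto simp: level_slope_def)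

lemma level_slope_mono: "mono_on {..1} (level_slope A)"
proof (rule mono_onI)
  fix x y :: real assume xy: "x \<in> {..1}" "y \<in> {..1}" "x \<le> y"
  show "level_slope A x \<le> level_slope A y"
  proof (cases "0 < x")
    case True
    hence "level_ratio A (1 / y) \<le> level_ratio A (1 / x)"
      using xy by (intro level_ratio_mono) (auto simp: frac_le)
    thus ?thesis
      using True xy monotone_onD[OF stdf_slope_antimono, of "level_ratio A (1 / y)" "level_ratio A (1 / x)"]
        level_ratio_nonneg by (auto simp: level_slope_def)
  next
    case False
    thus ?thesis using level_slope_bounds[of y] xy by (simp add: level_slope_def)
  qed
qed

lemma level_slope_has_integral:
  assumes "0 < z"
  shows "((\<lambda>x. level_slope A (x / z)) has_integral z * kendall_slope A) {0..z}"
proof -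
  have "level_slope A integrable_on cbox 0 1"
    using mono_on_subset[OF level_slope_mono] by (auto intro!: integrable_on_mono_on)
  hence "(level_slope A has_integral kendall_slope A) (cbox 0 1)"
    unfolding kendall_slope_def by (simp add: integrable_integral)
  from has_integral_affinity[OF this, of "1 / z" 0] assms
  show ?thesis by (simp add: image_mult_atLeastAtMost cbox_interval)
qed

lemma kendall_slope_bounds: "0 \<le> kendall_slope A" "kendall_slope A \<le> 1"
proof -
  have *: "(level_slope A has_integral kendall_slope A) {0..1}"
    using level_slope_has_integral[of 1] by simp
  show "0 \<le> kendall_slope A"
    using * level_slope_bounds by (intro has_integral_nonneg[OF *]) auto
  have "((\<lambda>_. 1) has_integral (1::real)) {0..1::real}"
    using has_integral_const_real[of "1::real" 0 1] by simp
  thus "kendall_slope A \<le> 1"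
    using level_slope_bounds by (intro has_integral_le[OF *]) auto
qed

text \<open>If \<open>kendall_slope A = 0\<close>, then by monotonicity \<open>level_slope A\<close> vanishes on \<open>(0, 1)\<close>. Wherever the
  section exceeds \<open>1\<close>, its tangent therefore passes through the origin; the bounds \<open>r \<le> stdf_section A r\<close> and
  slope \<open>\<le> 1\<close> leave only \<open>stdf_section A r = r\<close>. So the section is \<open>max 1 r\<close>, which means \<open>A = pickands_M\<close>.\<close>

lemma kendall_slope_pos:
  assumes "\<exists>t\<in>{0..1}. A t \<noteq> pickands_M t"
  shows "0 < kendall_slope A"
proof (rule ccontr)
  assume "\<not> ?thesis"
  hence 0: "kendall_slope A = 0" using kendall_slope_bounds by simp
  have zero: "level_slope A x = 0" if "0 < x" "x < 1" for x
  proof -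
    have int: "(level_slope A has_integral 0) {0..1}"
      using level_slope_has_integral[of 1] 0 by simp
    have sub: "level_slope A integrable_on {x..1}"
      by (rule integrable_subinterval_real[of _ 0 1]) (use int that in \<open>auto simp: has_integral_iff\<close>)
    have "integral {x..1} (\<lambda>_. level_slope A x) \<le> integral {x..1} (level_slope A)"
      using sub that mono_onD[OF level_slope_mono, of x] by (intro integral_le) auto
    also have "\<dots> \<le> integral {0..1} (level_slope A)"
      using sub int that level_slope_bounds by (intro integral_subset_le) (auto simp: has_integral_iff)
    also have "\<dots> = 0" using int by (simp add: has_integral_iff)
    finally have "(1 - x) * level_slope A x \<le> 0" using that by simp
    thus ?thesis using level_slope_bounds[of x] that by (simp add: mult_le_0_iff)
  qed
  have diag: "stdf_section A r = r" if r: "0 \<le> r" "1 < stdf_section A r" for r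
  proof (rule antisym)
    let ?f = "stdf_section A"
    define r' where "r' = level_ratio A (?f r)"
    have r': "0 \<le> r'" "?f r' = ?f r" "r \<le> r'"
      using level_ratio[of "?f r"] r section_le_iff[of "?f r" r] by (auto simp: r'_def)
    have "stdf_slope A r' = 0"
      using zero[of "1 / ?f r"] r by (auto simp: level_slope_def r'_def)
    hence eq: "?f r' = r' * right_slope ?f r'" by (simp add: stdf_slope_def)
    have pos: "0 < r'" using eq r' r by (cases "r' = 0") auto
    have "right_slope ?f r' \<le> 1" using section_slope_bounds r' by simp
    hence "?f r' \<le> r'" using eq pos by (simp add: mult_left_le)
    hence r'eq: "?f r' = r'" using section_bounds(2)[OF r'(1)] by simp
    hence m1: "right_slope ?f r' = 1" using eq pos by simp
    show "r \<le> ?f r" using section_bounds r by simp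
    have "r' = r"
    proof (rule ccontr)
      assume "r' \<noteq> r"
      hence "r < r'" using r' by simp
      define t where "t = r / r'"
      have t: "0 \<le> t" "t < 1" "r = t * r'" using \<open>r < r'\<close> r pos by (auto simp: t_def)
      have "?f ((1 - t) *\<^sub>R 0 + t *\<^sub>R r') \<le> (1 - t) * ?f 0 + t * ?f r'"
        using t pos by (intro convex_onD[OF section_convex]) auto
      hence "?f r \<le> (1 - t) + t * ?f r" using t r' by simp
      hence "(1 - t) * ?f r \<le> (1 - t) * 1" by (simp add: algebra_simps)
      hence "?f r \<le> 1" using t by (subst (asm) mult_le_cancel_left_pos) auto
      thus False using r by simp
    qed
    thus "?f r \<le> r" using r'eq r' by simp
  qed
  have sec: "stdf_section A r = max 1 r" if "0 \<le> r" for r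
    using diag[OF that] section_bounds[OF that] by (cases "1 < stdf_section A r") (auto simp: max_def)
  have "A t = pickands_M t" if t: "t \<in> {0..1}" for t
  proof (cases "t = 0")
    case True
    have "max (1 - t) t \<le> A t \<and> A t \<le> 1" using A t by (simp add: pickands_def)
    thus ?thesis using True by (auto simp: pickands_M_def)
  next
    case False
    have "A t = stdf A t (1 - t)" by (simp add: stdf_def)
    also have "\<dots> = t * max 1 ((1 - t) / t)"
      using False t by (subst stdf_eq_section) (auto simp: sec)
    also have "\<dots> = max t (1 - t)"
      using False t by (auto simp: max_def field_simps)
    finally show ?thesis by (simp add: pickands_M_def)
  qed
  thus False using assms by auto
qed

end

lemma independence_pickands: "(\<lambda>_. 1) \<in> pickands"
  by (auto simp: pickands_def convex_on_def)

lemma stdf_independence: "stdf (\<lambda>_. 1) x y = x + y"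
  by (simp add: stdf_def)

lemma kendall_slope_independence: "kendall_slope (\<lambda>_. 1) = 1"
proof -
  let ?A = "\<lambda>_::real. 1 :: real"
  have "right_slope (stdf_section ?A) r = 1" if "0 \<le> r" for r
  proof -
    have "(\<lambda>t. (stdf_section ?A t - stdf_section ?A r) / (t - r)) ` {r<..} = (\<lambda>t. 1) ` {r<..}"
      using that by (intro image_cong refl) (auto simp: stdf_section_def stdf_independence max_def)
    thus ?thesis by (simp add: right_slope_def)
  qed
  hence "stdf_slope ?A r = 1" if "0 \<le> r" for r
    using that by (simp add: stdf_slope_def stdf_section_def stdf_independence)
  hence one: "level_slope ?A x = 1" if "x \<in> {0..1} - {0}" for x
    using that level_ratio_nonneg[OF independence_pickands, of "1 / x"] by (auto simp: level_slope_def)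
  have "integral {0..1} (level_slope ?A) = integral {0..1::real} (\<lambda>_. 1 :: real)"
    by (rule integral_spike[of "{0}"]) (use one in simp_all)
  thus ?thesis by (simp add: kendall_slope_def)
qed

section \<open>Generators\<close>

definition generator_inv :: "(real \<Rightarrow> real) \<Rightarrow> real \<Rightarrow> real" where
  "generator_inv \<psi> y = enn2real (pseudo_inverse \<psi> y)"

text \<open>The density of a positive random variable with survival function \<open>\<psi>\<close>.\<close>

definition generator_density :: "(real \<Rightarrow> real) \<Rightarrow> real \<Rightarrow> real" where
  "generator_density \<psi> z = (if z > 0 then - right_slope \<psi> z else 0)"

context
  fixes \<psi> :: "real \<Rightarrow> real"
  assumes \<psi>: "\<psi> \<in> generators"
begin

lemma generator_bounds: "0 \<le> z \<Longrightarrow> 0 \<le> \<psi> z" "0 \<le> z \<Longrightarrow> \<psi> z \<le> 1"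
  using \<psi> by (auto simp: generators_def Pi_iff)

lemma generator_0: "\<psi> 0 = 1" and generator_1: "\<psi> 1 = 1 / 2"
  and generator_tendsto_0: "(\<psi> \<longlongrightarrow> 0) at_top"
  and generator_continuous: "continuous_on {0..} \<psi>"
  using \<psi> by (auto simp: generators_def)

lemma generator_antimono: "0 \<le> x \<Longrightarrow> x \<le> y \<Longrightarrow> \<psi> y \<le> \<psi> x"
  using \<psi> by (auto simp: generators_def monotone_on_def)

lemma generator_convex: "convex_on {0<..} \<psi>"
  using \<psi> by (auto simp: generators_def intro: convex_on_subset)

lemma generator_strict:
  assumes "0 \<le> x" "x < y" "0 < \<psi> x"
  shows "\<psi> y < \<psi> x"
proof (cases "\<psi> y = 0")
  case False
  hence pos: "0 < \<psi> y" using generator_bounds[of y] assms by simp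
  have "ennreal y < Inf (ennreal ` {x. 0 \<le> x \<and> \<psi> x = 0})"
  proof -
    obtain \<delta> where \<delta>: "\<delta> > 0" "\<And>t. 0 \<le> t \<Longrightarrow> dist t y < \<delta> \<Longrightarrow> dist (\<psi> t) (\<psi> y) < \<psi> y"
      using generator_continuous[unfolded continuous_on_iff] pos assms
      by (metis atLeast_iff less_imp_le order_trans)
    have pos': "0 < \<psi> (y + \<delta> / 2)"
      using \<delta>(2)[of "y + \<delta> / 2"] \<delta>(1) assms by (auto simp: dist_real_def)
    have "ennreal (y + \<delta> / 2) \<le> Inf (ennreal ` {x. 0 \<le> x \<and> \<psi> x = 0})"
    proof (intro Inf_greatest)
      fix w assume "w \<in> ennreal ` {x. 0 \<le> x \<and> \<psi> x = 0}"
      then obtain x where x: "w = ennreal x" "0 \<le> x" "\<psi> x = 0" by auto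
      have "y + \<delta> / 2 \<le> x"
        using generator_antimono[of x "y + \<delta> / 2"] x pos' by force
      thus "ennreal (y + \<delta> / 2) \<le> w" using x by (simp add: ennreal_leI)
    qed
    moreover have "ennreal y < ennreal (y + \<delta> / 2)"
      using \<delta>(1) assms by (intro ennreal_lessI) auto
    ultimately show ?thesis by simp
  qed
  moreover have "ennreal x < ennreal y" using assms by (intro ennreal_lessI) auto
  moreover have "strict_antimono_on {z. 0 \<le> z \<and> ennreal z < Inf (ennreal ` {x. 0 \<le> x \<and> \<psi> x = 0})} \<psi>"
    using \<psi> by (simp add: generators_def)
  ultimately show ?thesis
    using assms by (auto elim!: monotone_onD)
qed (use assms in simp)

lemma generator_surj:
  assumes "0 < y" "y \<le> 1"
  obtains z where "0 \<le> z" "\<psi> z = y"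
proof -
  have "eventually (\<lambda>z. \<psi> z < y) at_top"
    using generator_tendsto_0 assms(1) by (rule order_tendstoD)
  then obtain M where M: "\<psi> M < y" "0 \<le> M"
    using eventually_happens[OF eventually_conj[OF _ eventually_ge_at_top[of 0]]] by fastforce
  have "\<exists>z\<ge>0. z \<le> M \<and> \<psi> z = y"
    using M assms generator_0 continuous_on_subset[OF generator_continuous, of "{0..M}"]
    by (intro IVT2') auto
  thus ?thesis using that by auto
qed

lemma pseudo_inverse_generator:
  assumes "0 \<le> z" "0 < \<psi> z"
  shows "pseudo_inverse \<psi> (\<psi> z) = ennreal z"
proof -
  have "{w. generator_ext \<psi> w = \<psi> z} = {ennreal z}"
  proof safe
    fix w assume w: "generator_ext \<psi> w = \<psi> z"
    hence "w \<noteq> \<infinity>" using assms by (auto simp: generator_ext_def)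
    then obtain r where r: "w = ennreal r" "0 \<le> r" by (cases w) auto
    hence "\<psi> r = \<psi> z" using w by (simp add: generator_ext_def)
    hence "r = z" using generator_strict[of r z] generator_strict[of z r] assms r by force
    thus "w = ennreal z" using r by simp
  qed (use assms in \<open>simp add: generator_ext_def\<close>)
  thus ?thesis by (simp add: pseudo_inverse_def)
qed

lemma generator_inv_eq: "0 \<le> z \<Longrightarrow> 0 < \<psi> z \<Longrightarrow> generator_inv \<psi> (\<psi> z) = z"
  by (simp add: generator_inv_def pseudo_inverse_generator)

lemma generator_inv:
  assumes "0 < y" "y \<le> 1"
  shows generator_inv_nonneg: "0 \<le> generator_inv \<psi> y"
    and generator_generator_inv: "\<psi> (generator_inv \<psi> y) = y"
    and pseudo_inverse_eq: "pseudo_inverse \<psi> y = ennreal (generator_inv \<psi> y)"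
    and generator_less_iff: "0 \<le> s \<Longrightarrow> \<psi> s < y \<longleftrightarrow> generator_inv \<psi> y < s"
proof -
  obtain z where z: "0 \<le> z" "\<psi> z = y" using generator_surj assms by blast
  have eq: "generator_inv \<psi> y = z" using generator_inv_eq[of z] z assms by simp
  show "0 \<le> generator_inv \<psi> y" "\<psi> (generator_inv \<psi> y) = y" using eq z by auto
  show "pseudo_inverse \<psi> y = ennreal (generator_inv \<psi> y)"
    using pseudo_inverse_generator[of z] z assms eq by simp
  show "\<psi> s < y \<longleftrightarrow> generator_inv \<psi> y < s" if "0 \<le> s"
    using generator_strict[of z s] generator_antimono[of s z] z eq that assms by force
qed

lemma generator_inv_1: "generator_inv \<psi> 1 = 0"
  using generator_inv_eq[of 0] generator_0 by simp

lemma generator_inv_pos: "0 < y \<Longrightarrow> y < 1 \<Longrightarrow> 0 < generator_inv \<psi> y"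
  using generator_less_iff[of 1 0] generator_inv_nonneg[of y] generator_generator_inv[of y] generator_0
  by (cases "generator_inv \<psi> y = 0") auto

lemma generator_inv_antimono:
  assumes "0 < x" "x \<le> y" "y \<le> 1"
  shows "generator_inv \<psi> y \<le> generator_inv \<psi> x"
  using generator_less_iff[of y "generator_inv \<psi> x"] generator_generator_inv[of x] generator_inv_nonneg[of x]
    generator_less_iff[of x "generator_inv \<psi> y"] generator_generator_inv[of y] generator_inv_nonneg[of y] assms
  by force

lemma generator_density_bounds:
  assumes "0 < x" "x \<le> y"
  shows "generator_density \<psi> y * (y - x) \<le> \<psi> x - \<psi> y"
    and "\<psi> x - \<psi> y \<le> generator_density \<psi> x * (y - x)"
  using convex_increment_bounds[OF generator_convex assms] assms by (auto simp: generator_density_def)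

lemma generator_density_antimono:
  "0 < x \<Longrightarrow> x \<le> y \<Longrightarrow> generator_density \<psi> y \<le> generator_density \<psi> x"
  using mono_onD[OF right_slope_mono[OF generator_convex], of x y] by (simp add: generator_density_def)

lemma generator_density_nonneg: "0 \<le> generator_density \<psi> z"
proof (cases "0 < z")
  case True
  have "0 \<le> \<psi> z - \<psi> (z + 1)" using generator_antimono[of z "z + 1"] True by simp
  thus ?thesis using generator_density_bounds(2)[of z "z + 1"] True by simp
qed (simp add: generator_density_def)

lemma generator_density_le:
  assumes "0 < z"
  shows "generator_density \<psi> z \<le> 2 / z"
proof -
  have "generator_density \<psi> z * (z - z / 2) \<le> 1"
    using generator_density_bounds(1)[of "z / 2" z] generator_bounds[of "z / 2"] generator_bounds[of z] assms
    by auto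
  thus ?thesis using assms by (simp add: field_simps)
qed

lemma generator_density_pos_iff:
  assumes "0 < z"
  shows "0 < generator_density \<psi> z \<longleftrightarrow> 0 < \<psi> z"
proof
  assume "0 < \<psi> z"
  hence "0 < \<psi> z - \<psi> (z + 1)" using generator_strict[of z "z + 1"] assms by simp
  thus "0 < generator_density \<psi> z" using generator_density_bounds(2)[of z "z + 1"] assms by simp
next
  assume *: "0 < generator_density \<psi> z"
  show "0 < \<psi> z"
  proof (rule ccontr)
    assume "\<not> ?thesis"
    hence "\<psi> t = 0" if "z \<le> t" for t
      using generator_antimono[of z t] generator_bounds[of t] that assms by simp
    hence "generator_density \<psi> z = 0"
      using assms unfolding generator_density_def right_slope_def by (simp cong: INF_cong_simp)
    thus False using * by simp
  qed
qed

lemma generator_density_continuous_at_right: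
  assumes "0 < z"
  shows "(generator_density \<psi> \<longlongrightarrow> generator_density \<psi> z) (at_right z)"
proof -
  have "((\<lambda>z. - right_slope \<psi> z) \<longlongrightarrow> - right_slope \<psi> z) (at_right z)"
    by (intro tendsto_intros right_slope_continuous_at_right[OF generator_convex] assms)
  moreover have "eventually (\<lambda>t. - right_slope \<psi> t = generator_density \<psi> t) (at_right z)"
    using assms by (intro eventually_at_rightI[of z "z + 1"]) (auto simp: generator_density_def)
  ultimately show ?thesis
    using assms by (auto simp: generator_density_def[of \<psi> z] elim: Lim_transform_eventually)
qed

end

text \<open>Strict monotonicity comes for free: a convex function that takes the same positive value twice never
  falls below it afterwards and cannot tend to \<open>0\<close>.\<close>

lemma generatorsI:
  assumes range: "\<And>z. 0 \<le> z \<Longrightarrow> 0 \<le> \<psi> z \<and> \<psi> z \<le> 1"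
    and anti: "\<And>x y. 0 \<le> x \<Longrightarrow> x \<le> y \<Longrightarrow> \<psi> y \<le> \<psi> x"
    and cont: "continuous_on {0..} \<psi>" and cv: "convex_on {0..} \<psi>"
    and lim: "(\<psi> \<longlongrightarrow> 0) at_top" and "\<psi> 0 = 1" "\<psi> 1 = 1 / 2"
  shows "\<psi> \<in> generators"
proof -
  have strict: "\<psi> y < \<psi> x" if "0 \<le> x" "x < y" "\<psi> x \<noteq> 0" for x y
  proof (rule ccontr)
    assume "\<not> ?thesis"
    hence eq: "\<psi> y = \<psi> x" using anti[of x y] that by simp
    have "\<psi> x \<le> \<psi> t" if t: "y < t" for t
      using convex_on_slope_le(1)[OF cv, of x t y] t \<open>0 \<le> x\<close> \<open>x < y\<close> eq
      by (simp add: zero_le_divide_iff)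
    hence "eventually (\<lambda>t. \<psi> x \<le> \<psi> t) at_top"
      by (intro eventually_mono[OF eventually_gt_at_top[of y]])
    hence "\<psi> x \<le> 0" using lim by (intro tendsto_lowerbound) auto
    thus False using range[of x] that by simp
  qed
  have "strict_antimono_on {z. 0 \<le> z \<and> ennreal z < Inf (ennreal ` {x. 0 \<le> x \<and> \<psi> x = 0})} \<psi>"
  proof (rule monotone_onI)
    fix x y assume xy: "x \<in> {z. 0 \<le> z \<and> ennreal z < Inf (ennreal ` {x. 0 \<le> x \<and> \<psi> x = 0})}" "x < y"
    have "\<psi> x \<noteq> 0"
    proof
      assume "\<psi> x = 0"
      hence "Inf (ennreal ` {x. 0 \<le> x \<and> \<psi> x = 0}) \<le> ennreal x" using xy by (intro Inf_lower) auto
      thus False using xy by auto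
    qed
    thus "\<psi> y < \<psi> x" using strict xy by auto
  qed
  thus ?thesis using assms by (auto simp: generators_def monotone_on_def)
qed

lemma borel_measurable_generator_density [measurable]:
  assumes "\<psi> \<in> generators"
  shows "generator_density \<psi> \<in> borel_measurable borel"
proof -
  have "(\<lambda>x. - (if 0 < x then right_slope \<psi> x else 0)) \<in> borel_measurable borel"
    by (intro borel_measurable_uminus borel_measurable_if_mono_on right_slope_mono generator_convex assms)
  also have "(\<lambda>x. - (if 0 < x then right_slope \<psi> x else 0)) = generator_density \<psi>"
    by (auto simp: generator_density_def)
  finally show ?thesis .
qed

text \<open>The infimum of the zeros is itself a zero, by continuity, or \<open>\<infinity>\<close>.\<close>

lemma generator_ext_beyond_zero:
  assumes \<psi>: "\<psi> \<in> generators" and w: "pseudo_inverse \<psi> 0 \<le> w"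
  shows "generator_ext \<psi> w = 0"
proof (rule ccontr)
  assume nz: "generator_ext \<psi> w \<noteq> 0"
  then obtain r where r: "w = ennreal r" "0 \<le> r" by (cases w) (auto simp: generator_ext_def)
  hence pos: "0 < \<psi> r" using nz generator_bounds(1)[OF \<psi>, of r] by (simp add: generator_ext_def)
  obtain \<delta> where \<delta>: "\<delta> > 0" "\<And>t. 0 \<le> t \<Longrightarrow> dist t r < \<delta> \<Longrightarrow> dist (\<psi> t) (\<psi> r) < \<psi> r"
    using generator_continuous[OF \<psi>, unfolded continuous_on_iff] pos r by (metis atLeast_iff)
  have pos': "0 < \<psi> (r + \<delta> / 2)"
    using \<delta>(2)[of "r + \<delta> / 2"] \<delta>(1) r by (auto simp: dist_real_def)
  have "ennreal (r + \<delta> / 2) \<le> pseudo_inverse \<psi> 0"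
    unfolding pseudo_inverse_def
  proof (rule Inf_greatest)
    fix z assume z: "z \<in> {z. generator_ext \<psi> z = 0}"
    show "ennreal (r + \<delta> / 2) \<le> z"
    proof (cases z)
      case (real u)
      hence "\<psi> u = 0" using z by (simp add: generator_ext_def)
      hence "r + \<delta> / 2 \<le> u" using generator_antimono[OF \<psi>, of u "r + \<delta> / 2"] pos' real by force
      thus ?thesis using real by (simp add: ennreal_leI)
    qed simp
  qed
  also have "\<dots> \<le> ennreal r" using w r by simp
  finally have "r + \<delta> / 2 \<le> r" using r by (simp add: ennreal_le_iff)
  thus False using \<delta>(1) by simp
qed

section \<open>A random pair with survival function \<open>\<psi> (stdf A x y)\<close>\<close>

lemma emeasure_lborel_subgraph:
  fixes h :: "real \<Rightarrow> real"
  assumes [measurable]: "E \<in> sets borel" "h \<in> borel_measurable borel"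
  shows "{(x, p). x \<in> E \<and> 0 < p \<and> p < h x} \<in> sets borel"
    and "emeasure lborel {(x, p). x \<in> E \<and> 0 < p \<and> p < h x} = (\<integral>\<^sup>+x\<in>E. ennreal (h x) \<partial>lborel)"
proof -
  let ?S = "{(x, p). x \<in> E \<and> 0 < p \<and> p < h x}"
  have "{w \<in> space (borel \<Otimes>\<^sub>M borel). fst w \<in> E \<and> 0 < snd w \<and> snd w < h (fst w)} \<in> sets (borel \<Otimes>\<^sub>M borel)"
    by measurable
  also have "{w \<in> space (borel \<Otimes>\<^sub>M borel). fst w \<in> E \<and> 0 < snd w \<and> snd w < h (fst w)} = ?S"
    by (auto simp: space_pair_measure)
  finally have S: "?S \<in> sets (borel \<Otimes>\<^sub>M borel)" .
  thus "?S \<in> sets borel" unfolding borel_prod .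
  have S': "?S \<in> sets (lborel \<Otimes>\<^sub>M lborel)"
    using S by (simp cong: sets_pair_measure_cong)
  have "emeasure lborel ?S = emeasure (lborel \<Otimes>\<^sub>M lborel) ?S" by (simp add: lborel_prod)
  also have "\<dots> = (\<integral>\<^sup>+x. emeasure lborel (Pair x -` ?S) \<partial>lborel)"
    by (rule lborel.emeasure_pair_measure_alt[OF S'])
  also have "\<dots> = (\<integral>\<^sup>+x\<in>E. ennreal (h x) \<partial>lborel)"
  proof (rule nn_integral_cong)
    fix x
    have "Pair x -` ?S = (if x \<in> E then {0<..<h x} else {})" by auto
    thus "emeasure lborel (Pair x -` ?S) = ennreal (h x) * indicator E x"
      by (cases "0 \<le> h x") (auto simp: indicator_def ennreal_neg)
  qed
  finally show "emeasure lborel ?S = (\<integral>\<^sup>+x\<in>E. ennreal (h x) \<partial>lborel)" .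
qed

text \<open>Up to a null set of \<open>x\<close> this is the negative partial derivative of \<open>\<psi> (stdf A x y)\<close> in \<open>x\<close>, that is,
  the density of \<open>X\<close> at \<open>x\<close> on the event \<open>Y > y\<close>. Taking right derivatives of both \<open>stdf_section A\<close> and \<open>\<psi>\<close>
  makes it right-continuous in \<open>y\<close>.\<close>

definition cond_kernel :: "(real \<Rightarrow> real) \<Rightarrow> (real \<Rightarrow> real) \<Rightarrow> real \<Rightarrow> real \<Rightarrow> real" where
  "cond_kernel \<psi> A x y =
     (if 0 < x then stdf_slope A (y / x) * generator_density \<psi> (stdf A x y) else 0)"

text \<open>The sample space is the region under the graph of the density of \<open>X\<close>, with Lebesgue measure; the first
  coordinate then has this density, and the second one is uniform on \<open>(0, generator_density \<psi> x)\<close> given the first.\<close>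

definition sample_set :: "(real \<Rightarrow> real) \<Rightarrow> (real \<times> real) set" where
  "sample_set \<psi> = {(x, p). 0 < p \<and> p < generator_density \<psi> x}"

definition sample_space :: "(real \<Rightarrow> real) \<Rightarrow> (real \<times> real) measure" where
  "sample_space \<psi> = restrict_space lborel (sample_set \<psi>)"

text \<open>The quantile construction: \<open>Y\<close> is the generalized inverse of the decreasing function
  \<open>cond_kernel \<psi> A x\<close>, applied to the uniform coordinate \<open>p\<close>.\<close>

definition second_coord :: "(real \<Rightarrow> real) \<Rightarrow> (real \<Rightarrow> real) \<Rightarrow> real \<times> real \<Rightarrow> real" where
  "second_coord \<psi> A = (\<lambda>(x, p). Inf {y. 0 \<le> y \<and> cond_kernel \<psi> A x y \<le> p})"

context
  fixes \<psi> A :: "real \<Rightarrow> real"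
  assumes \<psi>: "\<psi> \<in> generators" and A: "A \<in> pickands"
begin

lemma cond_kernel_0: "cond_kernel \<psi> A x 0 = generator_density \<psi> x"
  using A by (simp add: cond_kernel_def stdf_slope_0 generator_density_def)

lemma cond_kernel_nonneg: "0 \<le> y \<Longrightarrow> 0 \<le> cond_kernel \<psi> A x y"
  using stdf_slope_bounds(1)[OF A, of "y / x"] generator_density_nonneg[OF \<psi>]
  by (simp add: cond_kernel_def)

lemma cond_kernel_antimono:
  assumes "0 \<le> y" "y \<le> y'"
  shows "cond_kernel \<psi> A x y' \<le> cond_kernel \<psi> A x y"
proof (cases "0 < x")
  case True
  have "stdf_slope A (y' / x) \<le> stdf_slope A (y / x)"
    using True assms by (intro monotone_onD[OF stdf_slope_antimono[OF A]]) (auto intro: divide_right_mono)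
  moreover have "generator_density \<psi> (stdf A x y') \<le> generator_density \<psi> (stdf A x y)"
    using True assms stdf_bounds(1)[OF A, of x y]
    by (intro generator_density_antimono[OF \<psi>] stdf_mono[OF A]) auto
  ultimately show ?thesis
    using True assms stdf_slope_bounds(1)[OF A] generator_density_nonneg[OF \<psi>]
    by (auto simp: cond_kernel_def intro!: mult_mono)
qed (simp add: cond_kernel_def)

lemma cond_kernel_le:
  assumes "0 < y"
  shows "cond_kernel \<psi> A x y \<le> 2 / y"
proof (cases "0 < x")
  case True
  have *: "y \<le> stdf A x y" using stdf_bounds(2)[OF A, of x y] True assms by simp
  have "cond_kernel \<psi> A x y \<le> 1 * generator_density \<psi> (stdf A x y)"
    unfolding cond_kernel_def using True assms stdf_slope_bounds(2)[OF A, of "y / x"] generator_density_nonneg[OF \<psi>]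
    by (auto intro!: mult_left_le_one_le stdf_slope_bounds[OF A])
  also have "\<dots> \<le> 1 * generator_density \<psi> y"
    using generator_density_antimono[OF \<psi> assms *] by simp
  also have "\<dots> \<le> 2 / y" using generator_density_le[OF \<psi> assms] by simp
  finally show ?thesis .
qed (use assms in \<open>simp add: cond_kernel_def\<close>)

lemma cond_kernel_continuous_at_right:
  assumes "0 \<le> y"
  shows "(cond_kernel \<psi> A x \<longlongrightarrow> cond_kernel \<psi> A x y) (at_right y)"
proof (cases "0 < x")
  case True
  have "((\<lambda>t. stdf_slope A (t / x)) \<longlongrightarrow> stdf_slope A (y / x)) (at_right y)"
  proof (rule filterlim_compose[OF stdf_slope_continuous_at_right[OF A]])
    show "0 \<le> y / x" using True assms by simp
    show "filterlim (\<lambda>t. t / x) (at_right (y / x)) (at_right y)"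
      using True by (auto simp: filterlim_at intro!: tendsto_intros eventually_at_rightI[of y "y + 1"] divide_strict_right_mono)
  qed
  moreover have "((\<lambda>t. generator_density \<psi> (stdf A x t)) \<longlongrightarrow> generator_density \<psi> (stdf A x y)) (at_right y)"
  proof (rule order_tendstoI)
    have pos: "0 < stdf A x y" using stdf_bounds(1)[OF A, of x y] True assms by simp
    have lim: "(stdf A x \<longlongrightarrow> stdf A x y) (at_right y)"
      using True assms by (intro stdf_tendsto[OF A] tendsto_intros eventually_at_rightI[of y "y + 1"]) auto
    {
      fix a assume "generator_density \<psi> (stdf A x y) < a"
      moreover have "generator_density \<psi> (stdf A x t) \<le> generator_density \<psi> (stdf A x y)" if "y < t" for t
        using that True assms pos by (intro generator_density_antimono[OF \<psi>] stdf_mono[OF A]) auto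
      ultimately show "eventually (\<lambda>t. generator_density \<psi> (stdf A x t) < a) (at_right y)"
        by (intro eventually_at_rightI[of y "y + 1"]) (auto intro: le_less_trans)
    }
    fix a assume a: "a < generator_density \<psi> (stdf A x y)"
    hence "eventually (\<lambda>s. a < generator_density \<psi> s) (at_right (stdf A x y))"
      by (rule order_tendstoD(1)[OF generator_density_continuous_at_right[OF \<psi> pos]])
    then obtain s where s: "stdf A x y < s" "\<And>u. stdf A x y < u \<Longrightarrow> u < s \<Longrightarrow> a < generator_density \<psi> u"
      by (auto simp: eventually_at_right_field)
    have "eventually (\<lambda>t. stdf A x t < s) (at_right y)" using lim s(1) by (rule order_tendstoD)
    moreover have "eventually (\<lambda>t. t \<in> {y<..<y + 1}) (at_right y)" by (rule eventually_at_right_real) simp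
    ultimately show "eventually (\<lambda>t. a < generator_density \<psi> (stdf A x t)) (at_right y)"
    proof eventually_elim
      case (elim t)
      hence "stdf A x y \<le> stdf A x t" using True assms by (intro stdf_mono[OF A]) auto
      thus ?case using s(2)[of "stdf A x t"] elim a by (cases "stdf A x y = stdf A x t") auto
    qed
  qed
  ultimately show ?thesis
    using True by (simp add: cond_kernel_def[abs_def] tendsto_mult)
qed (simp add: cond_kernel_def[abs_def])

lemma borel_measurable_cond_kernel:
  assumes "0 \<le> y"
  shows "(\<lambda>x. cond_kernel \<psi> A x y) \<in> borel_measurable borel"
proof -
  note [measurable] = borel_measurable_generator_density[OF \<psi>]
  have [measurable]: "(\<lambda>x. if 0 < x then stdf_slope A (y / x) else 0) \<in> borel_measurable borel"
    using assms by (intro borel_measurable_if_mono_on mono_onI monotone_onD[OF stdf_slope_antimono[OF A]])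
                   (auto simp: frac_le)
  have [measurable]: "(\<lambda>x. if 0 < x then stdf A x y else 0) \<in> borel_measurable borel"
    using assms by (intro borel_measurable_if_mono_on mono_onI stdf_mono[OF A]) auto
  have "(\<lambda>x. (if 0 < x then stdf_slope A (y / x) else 0) *
             generator_density \<psi> (if 0 < x then stdf A x y else 0)) \<in> borel_measurable borel"
    by measurable
  also have "(\<lambda>x. (if 0 < x then stdf_slope A (y / x) else 0) *
             generator_density \<psi> (if 0 < x then stdf A x y else 0)) = (\<lambda>x. cond_kernel \<psi> A x y)"
    by (auto simp: cond_kernel_def)
  finally show ?thesis .
qed

text \<open>Both \<open>- \<psi> (stdf A x b)\<close> and the integral of the kernel have increments between \<open>e x * g y * (y - x)\<close> and
  \<open>e y * g x * (y - x)\<close>, where \<open>e\<close> is the increasing factor of the kernel and \<open>g\<close> the decreasing one.\<close>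

lemma cond_kernel_has_integral:
  assumes "0 < a" "a \<le> c" "0 \<le> b"
  shows "((\<lambda>x. cond_kernel \<psi> A x b) has_integral (\<psi> (stdf A a b) - \<psi> (stdf A c b))) {a..c}"
proof -
  let ?e = "\<lambda>x. stdf_slope A (b / x)" and ?g = "\<lambda>x. generator_density \<psi> (stdf A x b)"
  have e: "0 \<le> ?e x" "?e x \<le> 1" "?e x \<le> ?e y" if "a \<le> x" "x \<le> y" for x y
    using that assms by (auto intro!: stdf_slope_bounds[OF A] monotone_onD[OF stdf_slope_antimono[OF A]] simp: frac_le)
  have pos: "0 < stdf A x b" if "a \<le> x" for x
    using stdf_bounds(1)[OF A, of x b] that assms by simp
  have g: "0 \<le> ?g x" "?g y \<le> ?g x" if "a \<le> x" "x \<le> y" for x y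
    using that assms pos[OF that(1)]
    by (auto intro!: generator_density_nonneg[OF \<psi>] generator_density_antimono[OF \<psi>] stdf_mono[OF A])
  have "integrable lborel (\<lambda>x. indicator {a..c} x *\<^sub>R cond_kernel \<psi> A x b)"
  proof (rule integrableI_bounded_set_indicator[where B = "?g a"])
    have "cond_kernel \<psi> A x b \<le> 1 * ?g a" if "a \<le> x" for x
      using that assms e[OF that order_refl] g[OF order_refl that] g(1)[OF that order_refl]
      unfolding cond_kernel_def by (auto intro!: order_trans[OF mult_left_le_one_le])
    thus "AE x in lborel. x \<in> {a..c} \<longrightarrow> norm (cond_kernel \<psi> A x b) \<le> ?g a"
      using assms cond_kernel_nonneg by auto
  qed (use borel_measurable_cond_kernel[OF assms(3)] in \<open>auto simp: emeasure_lborel_Icc_eq\<close>)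
  hence int: "(\<lambda>x. cond_kernel \<psi> A x b) integrable_on {a..c}"
    by (intro set_borel_integral_eq_integral(1)) (simp add: set_integrable_def)
  have "((\<lambda>x. cond_kernel \<psi> A x b) has_integral (- \<psi> (stdf A c b) - (- \<psi> (stdf A a b)))) {a..c}"
  proof (rule squeezed_integral[where lo = "\<lambda>x y. ?e x * ?g y" and hi = "\<lambda>x y. ?e y * ?g x"
                and B = "\<lambda>x. ?g a * ?e x - ?g x"])
    fix x y assume xy: "a \<le> x" "x \<le> y" "y \<le> c"
    have l: "?e x * (y - x) \<le> stdf A y b - stdf A x b" "stdf A y b - stdf A x b \<le> ?e y * (y - x)"
      using xy assms stdf_increment_bounds[OF A, of x y b] by auto
    have le: "stdf A x b \<le> stdf A y b" using xy assms by (intro stdf_mono[OF A]) auto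
    have "?e x * ?g y * (y - x) = ?g y * (?e x * (y - x))" by simp
    also have "\<dots> \<le> ?g y * (stdf A y b - stdf A x b)"
      using l(1) generator_density_nonneg[OF \<psi>] by (rule mult_left_mono)
    also have "\<dots> \<le> \<psi> (stdf A x b) - \<psi> (stdf A y b)"
      by (rule generator_density_bounds[OF \<psi> pos[OF xy(1)] le])
    finally have 1: "?e x * ?g y * (y - x) \<le> - \<psi> (stdf A y b) - (- \<psi> (stdf A x b))" by simp
    have "\<psi> (stdf A x b) - \<psi> (stdf A y b) \<le> ?g x * (stdf A y b - stdf A x b)"
      by (rule generator_density_bounds[OF \<psi> pos[OF xy(1)] le])
    also have "\<dots> \<le> ?g x * (?e y * (y - x))"
      using l(2) generator_density_nonneg[OF \<psi>] by (rule mult_left_mono)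
    finally show "?e x * ?g y * (y - x) \<le> - \<psi> (stdf A y b) - (- \<psi> (stdf A x b)) \<and>
        - \<psi> (stdf A y b) - (- \<psi> (stdf A x b)) \<le> ?e y * ?g x * (y - x)"
      using 1 by (simp add: mult_ac)
    have "?e y * ?g x - ?e x * ?g y = (?e y - ?e x) * ?g x + ?e x * (?g x - ?g y)"
      by (simp add: algebra_simps)
    also have "\<dots> \<le> (?e y - ?e x) * ?g a + 1 * (?g x - ?g y)"
      using e[OF xy(1) xy(2)] g[OF order_refl xy(1)] g[OF xy(1,2)]
      by (intro add_mono mult_left_mono mult_right_mono) auto
    finally show "?e y * ?g x - ?e x * ?g y \<le> (?g a * ?e y - ?g y) - (?g a * ?e x - ?g x)"
      by (simp add: algebra_simps)
  next
    fix x s y assume xy: "a \<le> x" "x \<le> s" "s \<le> y" "y \<le> c"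
    show "?e x * ?g y \<le> cond_kernel \<psi> A s b \<and> cond_kernel \<psi> A s b \<le> ?e y * ?g x"
      using xy assms e[of x s] e[of s y] g[of x s] g[of s y] e(1)[of y y] g(1)[of y y]
      by (auto simp: cond_kernel_def intro!: mult_mono)
  qed (use assms int in auto)
  thus ?thesis by simp
qed

lemma cond_kernel_nn_integral:
  assumes "0 \<le> a" "0 \<le> b"
  shows "(\<integral>\<^sup>+x\<in>{a<..}. ennreal (cond_kernel \<psi> A x b) \<partial>lborel) = ennreal (\<psi> (stdf A a b))"
proof -
  let ?N = "density lborel (\<lambda>x. ennreal (cond_kernel \<psi> A x b))"
  define I where "I n = {a + 1 / real (Suc n)..a + real (Suc n)}" for n
  note [measurable] = borel_measurable_cond_kernel[OF assms(2)]
  have step: "1 / real (Suc n) \<le> real (Suc n)" for n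
    by (rule order_trans[of _ 1]) auto
  have em: "emeasure ?N (I n) =
      ennreal (\<psi> (stdf A (a + 1 / real (Suc n)) b) - \<psi> (stdf A (a + real (Suc n)) b))" for n
  proof -
    have "emeasure ?N (I n) = (\<integral>\<^sup>+x. ennreal (cond_kernel \<psi> A x b) * indicator (I n) x \<partial>lborel)"
      by (simp add: emeasure_density I_def)
    also have "\<dots> = ennreal (\<psi> (stdf A (a + 1 / real (Suc n)) b) - \<psi> (stdf A (a + real (Suc n)) b))"
      unfolding I_def using assms step[of n]
      by (intro nn_integral_has_integral_lebesgue' cond_kernel_has_integral cond_kernel_nonneg)
         (auto intro: add_nonneg_pos)
    finally show ?thesis .
  qed
  have "incseq I"
  proof (rule incseq_SucI)
    fix n show "I n \<subseteq> I (Suc n)" unfolding I_def atLeastatMost_subset_iff by (auto simp: frac_le)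
  qed
  have "(\<lambda>n. emeasure ?N (I n)) \<longlonglongrightarrow> emeasure ?N (\<Union>n. I n)"
    by (rule Lim_emeasure_incseq[OF _ \<open>incseq I\<close>]) (auto simp: I_def)
  also have "(\<Union>n. I n) = {a<..}"
  proof (intro equalityI subsetI)
    fix x assume x: "x \<in> {a<..}"
    obtain n where n: "1 / real (Suc n) < x - a" using reals_Archimedean[of "x - a"] x by (auto simp: inverse_eq_divide)
    obtain m where m: "x - a < real m" using reals_Archimedean2 by blast
    have "1 / real (Suc (max n m)) \<le> 1 / real (Suc n)" by (simp add: frac_le)
    moreover have "real m \<le> real (Suc (max n m))" by simp
    ultimately have "x \<in> I (max n m)" using n m unfolding I_def atLeastAtMost_iff by linarith
    thus "x \<in> (\<Union>n. I n)" by blast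
  next
    fix x assume "x \<in> (\<Union>n. I n)"
    then obtain n where "a + 1 / real (Suc n) \<le> x" by (auto simp: I_def)
    moreover have "0 < 1 / real (Suc n)" by simp
    ultimately show "x \<in> {a<..}" unfolding greaterThan_iff by linarith
  qed
  finally have lim1: "(\<lambda>n. emeasure ?N (I n)) \<longlonglongrightarrow> emeasure ?N {a<..}" .
  have "(\<lambda>n. 1 / real (Suc n)) \<longlonglongrightarrow> 0" by (rule lim_1_over_n[THEN LIMSEQ_Suc])
  hence "(\<lambda>n. stdf A (a + 1 / real (Suc n)) b) \<longlonglongrightarrow> stdf A (a + 0) b"
    using assms by (intro stdf_tendsto[OF A] tendsto_intros) auto
  hence "(\<lambda>n. stdf A (a + 1 / real (Suc n)) b) \<longlonglongrightarrow> stdf A a b" by simp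
  hence "(\<lambda>n. \<psi> (stdf A (a + 1 / real (Suc n)) b)) \<longlonglongrightarrow> \<psi> (stdf A a b)"
  proof (rule continuous_on_tendsto_compose[OF generator_continuous[OF \<psi>]])
    have "0 \<le> stdf A x b" if "0 \<le> x" for x
      using stdf_bounds(1)[OF A that assms(2)] that by linarith
    thus "stdf A a b \<in> {0..}" "eventually (\<lambda>n. stdf A (a + 1 / real (Suc n)) b \<in> {0..}) sequentially"
      using assms by auto
  qed
  moreover have "(\<lambda>n. \<psi> (stdf A (a + real (Suc n)) b)) \<longlonglongrightarrow> 0"
  proof (rule filterlim_compose[OF generator_tendsto_0[OF \<psi>]])
    have "filterlim (\<lambda>n. real (Suc n)) at_top sequentially"
      using filterlim_real_sequentially filterlim_sequentially_Suc by blast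
    thus "filterlim (\<lambda>n. stdf A (a + real (Suc n)) b) at_top sequentially"
      by (rule filterlim_at_top_mono)
         (use assms in \<open>auto intro!: always_eventually order_trans[OF _ stdf_bounds(1)[OF A]]\<close>)
  qed
  ultimately have "(\<lambda>n. \<psi> (stdf A (a + 1 / real (Suc n)) b) - \<psi> (stdf A (a + real (Suc n)) b))
      \<longlonglongrightarrow> \<psi> (stdf A a b) - 0"
    by (rule tendsto_diff)
  hence "(\<lambda>n. emeasure ?N (I n)) \<longlonglongrightarrow> ennreal (\<psi> (stdf A a b))"
    unfolding em by (intro tendsto_ennrealI) simp
  hence "emeasure ?N {a<..} = ennreal (\<psi> (stdf A a b))"
    using lim1 LIMSEQ_unique by blast
  thus ?thesis by (simp add: emeasure_density)
qed

lemma sample_set_borel [measurable]: "sample_set \<psi> \<in> sets borel"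
  using emeasure_lborel_subgraph(1)[OF _ borel_measurable_generator_density[OF \<psi>], of UNIV]
  by (simp add: sample_set_def)

lemma sample_setD:
  assumes "(x, p) \<in> sample_set \<psi>"
  shows "0 < x" "0 < p" "0 < \<psi> x"
proof -
  have *: "0 < p" "p < generator_density \<psi> x" using assms by (auto simp: sample_set_def)
  thus "0 < p" "0 < x" by (auto simp: generator_density_def split: if_splits)
  thus "0 < \<psi> x" using generator_density_pos_iff[OF \<psi>, of x] * by linarith
qed

lemma space_sample_space: "space (sample_space \<psi>) = sample_set \<psi>"
  by (simp add: sample_space_def space_restrict_space)

lemma emeasure_sample_space:
  assumes "E \<in> sets borel" "E \<subseteq> sample_set \<psi>"
  shows "emeasure (sample_space \<psi>) E = emeasure lborel E"
  unfolding sample_space_def using assms by (intro emeasure_restrict_space) auto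

lemma second_coord:
  assumes "(x, p) \<in> sample_set \<psi>"
  shows second_coord_nonneg: "0 \<le> second_coord \<psi> A (x, p)"
    and less_second_coord_iff: "0 \<le> b \<Longrightarrow> b < second_coord \<psi> A (x, p) \<longleftrightarrow> p < cond_kernel \<psi> A x b"
proof -
  note xp = sample_setD[OF assms]
  let ?T = "{y. 0 \<le> y \<and> cond_kernel \<psi> A x y \<le> p}"
  have "2 / p \<in> ?T" using cond_kernel_le[of "2 / p" x] xp by simp
  hence ne: "?T \<noteq> {}" by blast
  have bdd: "bdd_below ?T" by (auto intro: bdd_belowI)
  show "0 \<le> second_coord \<psi> A (x, p)"
    using ne by (auto simp: second_coord_def intro: cInf_greatest)
  assume b: "0 \<le> b"
  show "b < second_coord \<psi> A (x, p) \<longleftrightarrow> p < cond_kernel \<psi> A x b"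
  proof
    assume *: "b < second_coord \<psi> A (x, p)"
    show "p < cond_kernel \<psi> A x b"
    proof (rule ccontr)
      assume "\<not> ?thesis"
      hence "Inf ?T \<le> b" using b bdd by (intro cInf_lower) auto
      thus False using * by (simp add: second_coord_def)
    qed
  next
    assume "p < cond_kernel \<psi> A x b"
    hence "eventually (\<lambda>y. p < cond_kernel \<psi> A x y) (at_right b)"
      by (rule order_tendstoD(1)[OF cond_kernel_continuous_at_right[OF b]])
    then obtain c where c: "b < c" "\<And>y. b < y \<Longrightarrow> y < c \<Longrightarrow> p < cond_kernel \<psi> A x y"
      by (auto simp: eventually_at_right_field)
    define m where "m = (b + c) / 2"
    have m: "b < m" "m < c" using c(1) by (auto simp: m_def)
    have "m \<le> Inf ?T"
    proof (rule cInf_greatest[OF ne])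
      fix y assume y: "y \<in> ?T"
      show "m \<le> y"
      proof (rule ccontr)
        assume "\<not> m \<le> y"
        hence "cond_kernel \<psi> A x m \<le> cond_kernel \<psi> A x y" using y by (intro cond_kernel_antimono) auto
        thus False using c(2)[OF m] y by simp
      qed
    qed
    thus "b < second_coord \<psi> A (x, p)" using m by (simp add: second_coord_def)
  qed
qed

lemma second_coord_pos:
  assumes "(x, p) \<in> sample_set \<psi>"
  shows "0 < second_coord \<psi> A (x, p)"
  using less_second_coord_iff[OF assms, of 0] assms by (auto simp: cond_kernel_0 sample_set_def)

text \<open>The event \<open>X > a, Y > b\<close> is again the region under a graph, so its probability is the integral
  \<open>cond_kernel_nn_integral\<close>.\<close>

lemma exceed_set:
  assumes "0 \<le> a" "0 \<le> b"
  shows "{w \<in> sample_set \<psi>. a < fst w \<and> b < second_coord \<psi> A w} =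
         {(x, p). x \<in> {a<..} \<and> 0 < p \<and> p < cond_kernel \<psi> A x b}"
proof -
  have "(x, p) \<in> sample_set \<psi> \<and> b < second_coord \<psi> A (x, p) \<longleftrightarrow> 0 < p \<and> p < cond_kernel \<psi> A x b" for x p
  proof -
    have "(x, p) \<in> sample_set \<psi>" if "0 < p" "p < cond_kernel \<psi> A x b"
      using that cond_kernel_antimono[OF order_refl assms(2), of x] by (simp add: sample_set_def cond_kernel_0)
    thus ?thesis using less_second_coord_iff[OF _ assms(2), of x p] sample_setD(2)[of x p] by blast
  qed
  thus ?thesis by auto
qed

lemma emeasure_exceed:
  assumes "0 \<le> a" "0 \<le> b"
  shows "{w \<in> sample_set \<psi>. a < fst w \<and> b < second_coord \<psi> A w} \<in> sets borel"
    and "emeasure (sample_space \<psi>) {w \<in> sample_set \<psi>. a < fst w \<and> b < second_coord \<psi> A w} =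
         ennreal (\<psi> (stdf A a b))"
proof -
  have meas: "{a<..} \<in> sets borel" "(\<lambda>x. cond_kernel \<psi> A x b) \<in> borel_measurable borel"
    using borel_measurable_cond_kernel[OF assms(2)] by auto
  show b: "{w \<in> sample_set \<psi>. a < fst w \<and> b < second_coord \<psi> A w} \<in> sets borel"
    unfolding exceed_set[OF assms] by (rule emeasure_lborel_subgraph[OF meas])
  have "emeasure (sample_space \<psi>) {w \<in> sample_set \<psi>. a < fst w \<and> b < second_coord \<psi> A w} =
    emeasure lborel {w \<in> sample_set \<psi>. a < fst w \<and> b < second_coord \<psi> A w}"
    by (rule emeasure_sample_space[OF b]) auto
  also have "\<dots> = ennreal (\<psi> (stdf A a b))"
    unfolding exceed_set[OF assms] emeasure_lborel_subgraph(2)[OF meas] cond_kernel_nn_integral[OF assms] ..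
  finally show "emeasure (sample_space \<psi>) {w \<in> sample_set \<psi>. a < fst w \<and> b < second_coord \<psi> A w} =
         ennreal (\<psi> (stdf A a b))" .
qed

lemma prob_space_sample_space: "prob_space (sample_space \<psi>)"
proof
  have "{w \<in> sample_set \<psi>. 0 < fst w \<and> 0 < second_coord \<psi> A w} = sample_set \<psi>"
    using sample_setD second_coord_pos by auto
  thus "emeasure (sample_space \<psi>) (space (sample_space \<psi>)) = 1"
    using emeasure_exceed(2)[of 0 0] generator_0[OF \<psi>] A by (simp add: space_sample_space stdf_0)
qed

lemma borel_measurable_fst_sample [measurable]: "fst \<in> borel_measurable (sample_space \<psi>)"
  unfolding sample_space_def by (intro measurable_restrict_space1) (simp add: borel_prod[symmetric])

lemma borel_measurable_second_coord [measurable]: "second_coord \<psi> A \<in> borel_measurable (sample_space \<psi>)"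
proof (rule borel_measurable_iff_greater[THEN iffD2], rule allI)
  fix b :: real
  have "{w \<in> sample_set \<psi>. b < second_coord \<psi> A w} \<in> sets borel"
  proof (cases "0 \<le> b")
    case True
    have "{w \<in> sample_set \<psi>. b < second_coord \<psi> A w} = {w \<in> sample_set \<psi>. 0 < fst w \<and> b < second_coord \<psi> A w}"
      using sample_setD(1) by auto
    thus ?thesis using emeasure_exceed(1)[OF order_refl True] by simp
  next
    case False
    hence "{w \<in> sample_set \<psi>. b < second_coord \<psi> A w} = sample_set \<psi>"
      using second_coord_nonneg by force
    thus ?thesis by simp
  qed
  thus "{w \<in> space (sample_space \<psi>). b < second_coord \<psi> A w} \<in> sets (sample_space \<psi>)"
    by (auto simp: space_sample_space sample_space_def sets_restrict_space_iff)
qed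

end

section \<open>Copulas and their measures\<close>

lemma sets_unit_square:
  "sets (restrict_space borel unit_square) =
   sigma_sets unit_square ((\<inter>) unit_square ` range (\<lambda>a::real \<times> real. {..a}))"
proof -
  have "sets (restrict_space borel unit_square) =
    (\<inter>) unit_square ` sigma_sets UNIV (range (\<lambda>a::real \<times> real. {..a}))"
    unfolding sets_restrict_space by (simp add: borel_eq_atMost)
  also have "\<dots> = sigma_sets unit_square ((\<inter>) unit_square ` range (\<lambda>a::real \<times> real. {..a}))"
  proof (rule sigma_sets_Int)
    have "closed unit_square" by (intro closed_Times closed_atLeastAtMost)
    hence "unit_square \<in> sets borel" by (rule borel_closed)
    thus "unit_square \<in> sigma_sets UNIV (range (\<lambda>a::real \<times> real. {..a}))"
      by (simp add: borel_eq_atMost)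
  qed simp
  finally show ?thesis .
qed

lemma unit_square_Int_atMost:
  "unit_square \<inter> {..(a, b)} = (if 0 \<le> a \<and> 0 \<le> b then {0..min 1 a} \<times> {0..min 1 b} else {})"
  by auto

text \<open>The intersections of the square with lower-left quadrants form an intersection-stable generator, and they are
  the rectangles anchored at the origin or empty.\<close>

lemma measure_eqI_unit_square:
  fixes M N :: "(real \<times> real) measure"
  assumes "sets M = sets (restrict_space borel unit_square)" "sets N = sets (restrict_space borel unit_square)"
    and eq: "\<And>x y. x \<in> {0..1} \<Longrightarrow> y \<in> {0..1} \<Longrightarrow> emeasure M ({0..x} \<times> {0..y}) = emeasure N ({0..x} \<times> {0..y})"
    and fin: "emeasure M unit_square \<noteq> \<infinity>"
  shows "M = N"
proof (rule measure_eqI_generator_eq[where \<Omega> = unit_square and A = "\<lambda>_. unit_square"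
          and E = "(\<inter>) unit_square ` range (\<lambda>a::real \<times> real. {..a})"])
  show "Int_stable ((\<inter>) unit_square ` range (\<lambda>a::real \<times> real. {..a}))"
  proof (rule Int_stableI)
    fix X Y assume "X \<in> (\<inter>) unit_square ` range (\<lambda>a::real \<times> real. {..a})"
      and "Y \<in> (\<inter>) unit_square ` range (\<lambda>a::real \<times> real. {..a})"
    then obtain a b where ab: "X = unit_square \<inter> {..a}" "Y = unit_square \<inter> {..b}" by blast
    have "{..a} \<inter> {..b} = {..inf a b}" by auto
    hence "X \<inter> Y = unit_square \<inter> {..inf a b}" unfolding ab by blast
    thus "X \<inter> Y \<in> (\<inter>) unit_square ` range (\<lambda>a::real \<times> real. {..a})" by blast
  qed
  show "(\<inter>) unit_square ` range (\<lambda>a::real \<times> real. {..a}) \<subseteq> Pow unit_square" by auto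
  show "sets M = sigma_sets unit_square ((\<inter>) unit_square ` range (\<lambda>a::real \<times> real. {..a}))"
    "sets N = sigma_sets unit_square ((\<inter>) unit_square ` range (\<lambda>a::real \<times> real. {..a}))"
    using assms(1,2) sets_unit_square by simp_all
  show "emeasure M X = emeasure N X" if "X \<in> (\<inter>) unit_square ` range (\<lambda>a::real \<times> real. {..a})" for X
  proof -
    obtain a b where "X = unit_square \<inter> {..(a, b)}" using \<open>X \<in> _\<close> by auto
    thus ?thesis using eq[of "min 1 a" "min 1 b"] by (auto simp only: unit_square_Int_atMost split: if_splits) auto
  qed
  have "unit_square = unit_square \<inter> {..(1, 1::real)}" by auto
  thus "range (\<lambda>_::nat. unit_square) \<subseteq> (\<inter>) unit_square ` range (\<lambda>a::real \<times> real. {..a})" by blast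
qed (use fin in auto)

text \<open>Copulas are increasing and 1-Lipschitz in each argument: compare the rectangle with the strips that reach to the
  lower, respectively upper, side of the square.\<close>

lemma copula_increment_bounds:
  assumes C: "is_copula C" and x: "x \<in> {0..1}" "x' \<in> {0..1}" "x \<le> x'" and y: "y \<in> {0..1}" "y' \<in> {0..1}" "y \<le> y'"
  shows "C (x, y) \<le> C (x', y')" "C (x', y') - C (x, y) \<le> (x' - x) + (y' - y)"
proof -
  have inc: "C (x2, y2) - C (x2, y1) - C (x1, y2) + C (x1, y1) \<ge> 0"
    if "x1 \<in> {0..1}" "x2 \<in> {0..1}" "y1 \<in> {0..1}" "y2 \<in> {0..1}" "x1 \<le> x2" "y1 \<le> y2" for x1 x2 y1 y2
    using C that unfolding is_copula_def by blast
  have bd: "C (t, 0) = 0" "C (0, t) = 0" "C (t, 1) = t" "C (1, t) = t" if "t \<in> {0..1}" for t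
    using C that unfolding is_copula_def by blast+
  have I: "(0::real) \<in> {0..1}" "(1::real) \<in> {0..1}" by auto
  show "C (x, y) \<le> C (x', y')"
    using inc[OF x(1,2) I(1) y(1) x(3)] inc[OF I(1) x(2) y(1,2) _ y(3)] bd x y by simp
  show "C (x', y') - C (x, y) \<le> (x' - x) + (y' - y)"
    using inc[OF x(1,2) y(1) I(2) x(3)] inc[OF x(2) I(2) y(1,2) _ y(3)] bd x y by simp
qed

lemma copula_continuous:
  assumes C: "is_copula C"
  shows "continuous_on unit_square C"
  unfolding continuous_on_iff
proof (intro ballI allI impI)
  fix w :: "real \<times> real" and \<epsilon> :: real assume w: "w \<in> unit_square" and \<epsilon>: "\<epsilon> > 0"
  obtain x y where xy: "w = (x, y)" "x \<in> {0..1}" "y \<in> {0..1}" using w by auto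
  have "dist (C v) (C w) < \<epsilon>" if v: "v \<in> unit_square" "dist v w < \<epsilon> / 2" for v
  proof -
    obtain x' y' where v': "v = (x', y')" "x' \<in> {0..1}" "y' \<in> {0..1}" using v by auto
    have d: "\<bar>x' - x\<bar> < \<epsilon> / 2" "\<bar>y' - y\<bar> < \<epsilon> / 2"
      using v(2) dist_fst_le[of v w] dist_snd_le[of v w] by (auto simp: v' xy dist_real_def)
    let ?m = "(min x x', min y y')"
    have "C ?m \<le> C v" "C v - C ?m \<le> (x' - min x x') + (y' - min y y')"
      "C ?m \<le> C w" "C w - C ?m \<le> (x - min x x') + (y - min y y')"
      unfolding v' xy using xy v' by (auto intro!: copula_increment_bounds[OF C])
    thus ?thesis using d by (auto simp: dist_real_def min_def split: if_splits)
  qed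
  thus "\<exists>d>0. \<forall>v\<in>unit_square. dist v w < d \<longrightarrow> dist (C v) (C w) < \<epsilon>"
    using \<epsilon> by (intro exI[of _ "\<epsilon> / 2"]) auto
qed

text \<open>Strict inequalities in the hypothesis suffice, although the copula measure is specified on closed rectangles:
  the strict version already makes \<open>C\<close> a copula, hence Lipschitz, and \<open>P (U \<le> x, V \<le> y)\<close> lies between
  \<open>C (x, y)\<close> and \<open>C (x', y')\<close> for all slightly larger \<open>x'\<close> and \<open>y'\<close>.\<close>

lemma copula_of_random_pair:
  fixes U V :: "'a \<Rightarrow> real"
  assumes "prob_space M" and [measurable]: "U \<in> borel_measurable M" "V \<in> borel_measurable M"
    and range: "\<And>w. w \<in> space M \<Longrightarrow> U w \<in> {0..<1} \<and> V w \<in> {0..<1}"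
    and ext: "C \<in> extensional unit_square"
    and cdf: "\<And>x y. x \<in> {0..1} \<Longrightarrow> y \<in> {0..1} \<Longrightarrow> measure M {w \<in> space M. U w < x \<and> V w < y} = C (x, y)"
    and margins: "\<And>x. x \<in> {0..1} \<Longrightarrow> C (x, 1) = x \<and> C (1, x) = x"
  shows "is_copula C"
    and "copula_measure C = distr M (restrict_space borel unit_square) (\<lambda>w. (U w, V w))"
proof -
  interpret prob_space M by fact
  define S where "S x y = {w \<in> space M. U w < x \<and> V w < y}" for x y
  have S [measurable]: "S x y \<in> sets M" for x y unfolding S_def by measurable
  have S_fm: "S x y \<in> fmeasurable M" for x y using S by (simp add: fmeasurable_eq_sets)
  have cdf': "measure M (S x y) = C (x, y)" if "x \<in> {0..1}" "y \<in> {0..1}" for x y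
    using cdf[OF that] by (simp add: S_def)
  show cop: "is_copula C"
    unfolding is_copula_def
  proof (intro conjI ballI impI ext)
    fix x :: real assume x: "x \<in> {0..1}"
    have "S x 0 = {}" "S 0 x = {}" using range by (force simp: S_def)+
    thus "C (x, 0) = 0" "C (0, x) = 0" using cdf'[of x 0] cdf'[of 0 x] x by simp_all
    show "C (x, 1) = x" "C (1, x) = x" using margins[OF x] by auto
  next
    fix x1 x2 y1 y2 :: real
    assume *: "x1 \<in> {0..1}" "x2 \<in> {0..1}" "y1 \<in> {0..1}" "y2 \<in> {0..1}" "x1 \<le> x2" "y1 \<le> y2"
    have "S x2 y1 \<inter> S x1 y2 = S x1 y1" using * by (auto simp: S_def)
    hence "measure M (S x2 y1 \<union> S x1 y2) = C (x2, y1) + C (x1, y2) - C (x1, y1)"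
      using measure_Un3[OF S_fm S_fm, of x2 y1 x1 y2] * by (simp add: cdf')
    moreover have "measure M (S x2 y1 \<union> S x1 y2) \<le> measure M (S x2 y2)"
      using * by (intro finite_measure_mono) (auto simp: S_def)
    ultimately show "C (x2, y2) - C (x2, y1) - C (x1, y2) + C (x1, y1) \<ge> 0"
      using * by (simp add: cdf')
  qed
  let ?D = "distr M (restrict_space borel unit_square) (\<lambda>w. (U w, V w))"
  have meas: "(\<lambda>w. (U w, V w)) \<in> measurable M (restrict_space borel unit_square)"
  proof (rule measurable_restrict_space2)
    show "(\<lambda>w. (U w, V w)) \<in> space M \<rightarrow> unit_square" using range by force
    show "(\<lambda>w. (U w, V w)) \<in> borel_measurable M" by measurable
  qed
  have closed: "measure M {w \<in> space M. U w \<le> x \<and> V w \<le> y} = C (x, y)" if xy: "x \<in> {0..1}" "y \<in> {0..1}" for x y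
  proof (rule antisym)
    show "measure M {w \<in> space M. U w \<le> x \<and> V w \<le> y} \<le> C (x, y)"
    proof (rule field_le_epsilon)
      fix e :: real assume e: "0 < e"
      \<comment> \<open>Truncation at \<open>1\<close> loses nothing, since \<open>U\<close> and \<open>V\<close> stay below \<open>1\<close>.\<close>
      define x' y' where "x' = min 1 (x + e / 2)" and "y' = min 1 (y + e / 2)"
      have I: "x' \<in> {0..1}" "y' \<in> {0..1}" "x \<le> x'" "y \<le> y'" "x' - x \<le> e / 2" "y' - y \<le> e / 2"
        using xy e by (auto simp: x'_def y'_def min_def)
      have "{w \<in> space M. U w \<le> x \<and> V w \<le> y} \<subseteq> S x' y'"
        using range e by (fastforce simp: S_def x'_def y'_def)
      hence "measure M {w \<in> space M. U w \<le> x \<and> V w \<le> y} \<le> C (x', y')"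
        using finite_measure_mono[OF _ S] cdf'[OF I(1,2)] by metis
      also have "\<dots> \<le> C (x, y) + e"
        using copula_increment_bounds(2)[OF cop xy(1) I(1,3) xy(2) I(2,4)] I by linarith
      finally show "measure M {w \<in> space M. U w \<le> x \<and> V w \<le> y} \<le> C (x, y) + e" .
    qed
    have "measure M (S x y) \<le> measure M {w \<in> space M. U w \<le> x \<and> V w \<le> y}"
      by (rule finite_measure_mono) (auto simp: S_def)
    thus "C (x, y) \<le> measure M {w \<in> space M. U w \<le> x \<and> V w \<le> y}" using cdf'[OF xy] by simp
  qed
  have D: "emeasure ?D ({0..x} \<times> {0..y}) = ennreal (C (x, y))" if xy: "x \<in> {0..1}" "y \<in> {0..1}" for x y
  proof -
    have "closed ({0..x} \<times> {0..y})" by (intro closed_Times closed_atLeastAtMost)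
    hence "{0..x} \<times> {0..y} \<in> sets (restrict_space borel unit_square)"
      using xy by (subst sets_restrict_space_iff) (auto intro!: borel_closed closed_Times)
    hence "emeasure ?D ({0..x} \<times> {0..y}) = emeasure M ((\<lambda>w. (U w, V w)) -` ({0..x} \<times> {0..y}) \<inter> space M)"
      by (rule emeasure_distr[OF meas])
    also have "(\<lambda>w. (U w, V w)) -` ({0..x} \<times> {0..y}) \<inter> space M = {w \<in> space M. U w \<le> x \<and> V w \<le> y}"
      using range by force
    finally show ?thesis using closed[OF xy] by (simp add: emeasure_eq_measure)
  qed
  show "copula_measure C = ?D"
    unfolding copula_measure_def
  proof (rule the_equality)
    show "sets ?D = sets (restrict_space borel unit_square) \<and>
      (\<forall>x\<in>{0..1}. \<forall>y\<in>{0..1}. emeasure ?D ({0..x} \<times> {0..y}) = ennreal (C (x, y)))"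
      using D by simp
  next
    fix N assume N: "sets N = sets (restrict_space borel unit_square) \<and>
      (\<forall>x\<in>{0..1}. \<forall>y\<in>{0..1}. emeasure N ({0..x} \<times> {0..y}) = ennreal (C (x, y)))"
    have one: "(1::real) \<in> {0..1}" by simp
    have "emeasure N unit_square = ennreal (C (1, 1))" using N one by blast
    thus "N = ?D" using N D by (intro measure_eqI_unit_square) auto
  qed
qed

section \<open>The law of an Archimax copula\<close>

text \<open>The strict version of the Kendall distribution is easier to compute, because \<open>\<psi> s < t\<close> is
  equivalent to \<open>\<phi> t < s\<close> for \<open>0 < t \<le> 1\<close>, and survival functions are given by strict inequalities.\<close>

definition kendall_strict :: "(real \<times> real \<Rightarrow> real) \<Rightarrow> real \<Rightarrow> real" where
  "kendall_strict C t = measure (copula_measure C) {p \<in> unit_square. C p < t}"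

context
  fixes \<psi> A :: "real \<Rightarrow> real"
  assumes \<psi>: "\<psi> \<in> generators" and A: "A \<in> pickands"
begin

lemma archimax_copula_eq:
  assumes "x \<in> {0..1}" "y \<in> {0..1}"
  shows "archimax_copula \<psi> A (x, y) =
    (if x = 0 \<or> y = 0 then 0 else \<psi> (stdf A (generator_inv \<psi> x) (generator_inv \<psi> y)))"
proof -
  have inv: "0 \<le> generator_inv \<psi> u" "\<psi> (generator_inv \<psi> u) = u" if "u \<in> {0..1}" "u \<noteq> 0" for u
    using generator_inv(1,2)[OF \<psi>, of u] that by auto
  show ?thesis
    using assms inv generator_inv_1[OF \<psi>]
    by (auto simp: archimax_copula_def copula_extension_def Let_def generator_inv_def[symmetric] stdf_0[OF A])
       (simp add: stdf_def)
qed

lemma archimax_copula_extensional: "archimax_copula \<psi> A \<in> extensional unit_square"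
  by (simp add: archimax_copula_def copula_extension_def)

definition "first_margin w = \<psi> (fst w)"
definition "second_margin w = \<psi> (second_coord \<psi> A w)"

lemma borel_measurable_generator_comp:
  assumes [measurable]: "Z \<in> borel_measurable M" and pos: "\<And>w. w \<in> space M \<Longrightarrow> 0 < Z w"
  shows "(\<lambda>w. \<psi> (Z w)) \<in> borel_measurable M"
proof -
  have "(\<lambda>x. if 0 < x then - \<psi> x else 0) \<in> borel_measurable borel"
    by (intro borel_measurable_if_mono_on mono_onI) (simp add: generator_antimono[OF \<psi>])
  from measurable_compose[OF assms(1) this]
  have "(\<lambda>w. - (if 0 < Z w then - \<psi> (Z w) else 0)) \<in> borel_measurable M" by (intro borel_measurable_uminus)
  thus ?thesis by (rule measurable_cong[THEN iffD1, rotated]) (use pos in auto)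
qed

lemma margins_measurable [measurable]:
  "first_margin \<in> borel_measurable (sample_space \<psi>)"
  "second_margin \<in> borel_measurable (sample_space \<psi>)"
proof -
  show "first_margin \<in> borel_measurable (sample_space \<psi>)"
    unfolding first_margin_def[abs_def]
    by (rule borel_measurable_generator_comp[OF borel_measurable_fst_sample[OF \<psi> A]])
       (use sample_setD[OF \<psi> A] in \<open>auto simp: space_sample_space[OF \<psi> A]\<close>)
  show "second_margin \<in> borel_measurable (sample_space \<psi>)"
    unfolding second_margin_def[abs_def]
    by (rule borel_measurable_generator_comp[OF borel_measurable_second_coord[OF \<psi> A]])
       (use second_coord_pos[OF \<psi> A] in \<open>auto simp: space_sample_space[OF \<psi> A]\<close>)
qed

lemma generator_less_1: "0 < z \<Longrightarrow> \<psi> z < 1"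
  using generator_strict[OF \<psi>, of 0 z] generator_0[OF \<psi>] by simp

lemma margins_range:
  assumes "w \<in> sample_set \<psi>"
  shows "first_margin w \<in> {0<..<1}" "second_margin w \<in> {0..<1}"
proof -
  obtain x p where w: "w = (x, p)" by (cases w)
  show "first_margin w \<in> {0<..<1}" "second_margin w \<in> {0..<1}"
    using sample_setD[OF \<psi> A, of x p] second_coord_pos[OF \<psi> A, of x p] assms
      generator_less_1 generator_bounds[OF \<psi>, of "second_coord \<psi> A (x, p)"]
    by (auto simp: w first_margin_def second_margin_def)
qed

lemma archimax_cdf:
  assumes x: "x \<in> {0..1}" and y: "y \<in> {0..1}"
  shows "measure (sample_space \<psi>) {w \<in> space (sample_space \<psi>). first_margin w < x \<and> second_margin w < y} =
    archimax_copula \<psi> A (x, y)"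
proof (cases "x = 0 \<or> y = 0")
  case True
  hence "{w \<in> space (sample_space \<psi>). first_margin w < x \<and> second_margin w < y} = {}"
    using margins_range by (force simp: space_sample_space[OF \<psi> A])
  thus ?thesis using True archimax_copula_eq[OF x y] by (simp only: measure_empty if_True)
next
  case False
  let ?a = "generator_inv \<psi> x" and ?b = "generator_inv \<psi> y"
  have pos: "0 < x" "x \<le> 1" "0 < y" "y \<le> 1" using x y False by auto
  have nn: "0 \<le> ?a" "0 \<le> ?b" using generator_inv_nonneg[OF \<psi>] pos by auto
  have "first_margin w < x \<longleftrightarrow> ?a < fst w" "second_margin w < y \<longleftrightarrow> ?b < second_coord \<psi> A w"
    if w: "w \<in> sample_set \<psi>" for w
  proof -
    obtain u p where up: "w = (u, p)" by (cases w)
    show "first_margin w < x \<longleftrightarrow> ?a < fst w" "second_margin w < y \<longleftrightarrow> ?b < second_coord \<psi> A w"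
      using generator_less_iff[OF \<psi> pos(1,2), of u] generator_less_iff[OF \<psi> pos(3,4), of "second_coord \<psi> A w"]
        sample_setD(1)[OF \<psi> A, of u p] second_coord_nonneg[OF \<psi> A, of u p] w
      by (auto simp: up first_margin_def second_margin_def)
  qed
  hence "{w \<in> space (sample_space \<psi>). first_margin w < x \<and> second_margin w < y} =
     {w \<in> sample_set \<psi>. ?a < fst w \<and> ?b < second_coord \<psi> A w}"
    by (auto simp: space_sample_space[OF \<psi> A])
  moreover have "0 \<le> stdf A ?a ?b" using stdf_bounds(1)[OF A nn] nn by linarith
  ultimately show ?thesis
    using emeasure_exceed(2)[OF \<psi> A nn] archimax_copula_eq[OF x y] False generator_bounds[OF \<psi>]
    by (simp add: measure_def)
qed

lemma archimax:
  shows archimax_is_copula: "is_copula (archimax_copula \<psi> A)"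
    and archimax_measure: "copula_measure (archimax_copula \<psi> A) =
      distr (sample_space \<psi>) (restrict_space borel unit_square) (\<lambda>w. (first_margin w, second_margin w))"
proof -
  have range: "first_margin w \<in> {0..<1} \<and> second_margin w \<in> {0..<1}" if "w \<in> space (sample_space \<psi>)" for w
    using that margins_range[of w] by (auto simp: space_sample_space[OF \<psi> A])
  have margins: "archimax_copula \<psi> A (x, 1) = x \<and> archimax_copula \<psi> A (1, x) = x" if "x \<in> {0..1}" for x
    using that by (auto simp: archimax_copula_def copula_extension_def)
  note * = copula_of_random_pair[OF prob_space_sample_space[OF \<psi> A] margins_measurable range
    archimax_copula_extensional archimax_cdf margins]
  show "is_copula (archimax_copula \<psi> A)" "copula_measure (archimax_copula \<psi> A) =
      distr (sample_space \<psi>) (restrict_space borel unit_square) (\<lambda>w. (first_margin w, second_margin w))"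
    by (rule *; assumption)+
qed

lemma margins_pair_measurable:
  "(\<lambda>w. (first_margin w, second_margin w)) \<in> measurable (sample_space \<psi>) (restrict_space borel unit_square)"
proof (rule measurable_restrict_space2)
  show "(\<lambda>w. (first_margin w, second_margin w)) \<in> space (sample_space \<psi>) \<rightarrow> unit_square"
    using margins_range by (force simp: space_sample_space[OF \<psi> A])
  show "(\<lambda>w. (first_margin w, second_margin w)) \<in> borel_measurable (sample_space \<psi>)"
    by measurable
qed

lemma archimax_measurable: "archimax_copula \<psi> A \<in> borel_measurable (restrict_space borel unit_square)"
  using archimax_is_copula by (intro borel_measurable_continuous_on_restrict copula_continuous)

text \<open>If \<open>\<psi> Y = 0\<close>, the copula vanishes at the point, and so does \<open>\<psi> (stdf A X Y)\<close> since
  \<open>Y \<le> stdf A X Y\<close>; otherwise \<open>\<psi>\<close> is injective at \<open>X\<close> and \<open>Y\<close>.\<close>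

lemma archimax_of_margins:
  assumes w: "(x, p) \<in> sample_set \<psi>"
  shows "archimax_copula \<psi> A (first_margin (x, p), second_margin (x, p)) = \<psi> (stdf A x (second_coord \<psi> A (x, p)))"
proof -
  let ?y = "second_coord \<psi> A (x, p)"
  have x: "0 < x" "0 < \<psi> x" and y: "0 < ?y"
    using sample_setD[OF \<psi> A w] second_coord_pos[OF \<psi> A w] by auto
  have *: "archimax_copula \<psi> A (first_margin (x, p), second_margin (x, p)) =
    (if \<psi> x = 0 \<or> \<psi> ?y = 0 then 0 else \<psi> (stdf A (generator_inv \<psi> (\<psi> x)) (generator_inv \<psi> (\<psi> ?y))))"
    using margins_range[OF w] by (subst archimax_copula_eq) (auto simp: first_margin_def second_margin_def)
  show ?thesis
  proof (cases "\<psi> ?y = 0")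
    case True
    have "?y \<le> stdf A x ?y" using stdf_bounds(2)[OF A, of x ?y] x y by simp
    hence "\<psi> (stdf A x ?y) \<le> 0" using generator_antimono[OF \<psi>, of ?y "stdf A x ?y"] y True by simp
    moreover have "0 \<le> \<psi> (stdf A x ?y)"
      using generator_bounds(1)[OF \<psi>, of "stdf A x ?y"] \<open>?y \<le> stdf A x ?y\<close> y by simp
    ultimately show ?thesis using * True by simp
  next
    case False
    hence "0 < \<psi> ?y" using generator_bounds(1)[OF \<psi>, of ?y] y by simp
    thus ?thesis using * x y by (simp add: generator_inv_eq[OF \<psi>])
  qed
qed

lemma stdf_level_iff:
  assumes "0 < x" "x \<le> z" "0 \<le> y"
  shows "stdf A x y \<le> z \<longleftrightarrow> y \<le> x * level_ratio A (z / x)"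
proof -
  have "stdf A x y \<le> z \<longleftrightarrow> stdf_section A (y / x) \<le> z / x"
    using assms by (simp add: stdf_eq_section[OF A] field_simps)
  also have "\<dots> \<longleftrightarrow> y / x \<le> level_ratio A (z / x)"
    using assms by (intro section_le_iff[OF A]) auto
  also have "\<dots> \<longleftrightarrow> y \<le> x * level_ratio A (z / x)"
    using assms by (simp add: field_simps)
  finally show ?thesis .
qed

text \<open>In the sample space the event \<open>stdf A X Y > z\<close> is the region under the graph of a function \<open>h\<close>. For \<open>x > z\<close>
  this is the whole density. For \<open>x \<le> z\<close> it is the kernel at the level curve, where the factor
  \<open>generator_density \<psi> (stdf A x y)\<close> is constant.\<close>

lemma kendall_strict_archimax:
  assumes z: "0 < z" "0 < \<psi> z"
  shows "kendall_strict (archimax_copula \<psi> A) (\<psi> z) = \<psi> z + kendall_slope A * (z * generator_density \<psi> z)"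
proof -
  let ?C = "archimax_copula \<psi> A" and ?g = "generator_density \<psi>"
  define h where "h x = (if z < x then ?g x else level_slope A (x / z) * ?g z)" for x
  note [measurable] = borel_measurable_generator_density[OF \<psi>]
  \<comment> \<open>Truncation at \<open>1\<close>, because \<open>level_slope A\<close> is monotone only there.\<close>
  have [measurable]: "(\<lambda>x. level_slope A (min 1 (x / z))) \<in> borel_measurable borel"
    using z by (intro borel_measurable_mono monoI mono_onD[OF level_slope_mono[OF A]])
               (auto simp: min_def divide_right_mono field_simps)
  have "(\<lambda>x. if z < x then ?g x else level_slope A (min 1 (x / z)) * ?g z) \<in> borel_measurable borel"
    by measurable
  also have "(\<lambda>x. if z < x then ?g x else level_slope A (min 1 (x / z)) * ?g z) = h"
    using z by (auto simp: h_def fun_eq_iff min_def field_simps)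
  finally have h [measurable]: "h \<in> borel_measurable borel" .
  have iff: "?C (first_margin (x, p), second_margin (x, p)) < \<psi> z \<longleftrightarrow> p < h x"
    if w: "(x, p) \<in> sample_set \<psi>" for x p
  proof -
    let ?y = "second_coord \<psi> A (x, p)"
    have x: "0 < x" and y: "0 \<le> ?y" using sample_setD[OF \<psi> A w] second_coord_nonneg[OF \<psi> A w] by auto
    have nn: "0 \<le> stdf A x ?y" using stdf_bounds(1)[OF A, of x ?y] x y by linarith
    have "?C (first_margin (x, p), second_margin (x, p)) < \<psi> z \<longleftrightarrow> \<psi> (stdf A x ?y) < \<psi> z"
      by (simp add: archimax_of_margins[OF w])
    also have "\<dots> \<longleftrightarrow> z < stdf A x ?y"
      using generator_less_iff[OF \<psi> z(2), of "stdf A x ?y"] generator_inv_eq[OF \<psi>, of z]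
        generator_bounds[OF \<psi>, of z] z nn by simp
    also have "\<dots> \<longleftrightarrow> p < h x"
    proof (cases "z < x")
      case True
      have "p < ?g x" using w by (simp add: sample_set_def)
      thus ?thesis using True stdf_bounds(1)[OF A, of x ?y] x y by (auto simp: h_def)
    next
      case False
      let ?b = "x * level_ratio A (z / x)"
      have zx: "1 \<le> z / x" using False x by simp
      have b: "0 \<le> ?b" using level_ratio_nonneg[OF A zx] x by simp
      have "stdf A x ?b = z"
        using x b section_level_ratio[OF A zx] by (simp add: stdf_eq_section[OF A])
      hence k: "cond_kernel \<psi> A x ?b = h x"
        using x z False by (simp add: cond_kernel_def h_def level_slope_def)
      have "z < stdf A x ?y \<longleftrightarrow> ?b < ?y"
        using stdf_level_iff[OF x _ y, of z] False by (simp add: not_le[symmetric])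
      also have "\<dots> \<longleftrightarrow> p < h x" using less_second_coord_iff[OF \<psi> A w b] k by simp
      finally show ?thesis .
    qed
    finally show ?thesis .
  qed
  have h_le: "h x \<le> ?g x" if "0 < x" for x
  proof (cases "z < x")
    case False
    have "level_slope A (x / z) * ?g z \<le> 1 * ?g x"
      using False that z level_slope_bounds[OF A, of "x / z"] generator_density_nonneg[OF \<psi>]
      by (intro mult_mono generator_density_antimono[OF \<psi>]) auto
    thus ?thesis using False by (simp add: h_def)
  qed (simp add: h_def)
  have h_0: "h x = 0" if "x \<le> 0" for x
  proof -
    have "\<not> z < x" "\<not> 0 < x / z" using that z by (auto simp: field_simps)
    thus ?thesis by (simp add: h_def level_slope_def)
  qed
  have set: "{w \<in> sample_set \<psi>. ?C (first_margin w, second_margin w) < \<psi> z} =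
    {(x, p). x \<in> UNIV \<and> 0 < p \<and> p < h x}"
  proof -
    have "(x, p) \<in> sample_set \<psi> \<and> p < h x \<longleftrightarrow> 0 < p \<and> p < h x" for x p
      using h_le[of x] h_0[of x] by (cases "0 < x") (auto simp: sample_set_def)
    thus ?thesis using iff by auto
  qed
  have sq: "space (restrict_space borel unit_square) = unit_square" by (simp add: space_restrict_space)
  have "{p \<in> unit_square. ?C p < \<psi> z} = {p \<in> space (restrict_space borel unit_square). ?C p < \<psi> z}"
    unfolding sq ..
  also have "\<dots> \<in> sets (restrict_space borel unit_square)"
    using archimax_measurable by measurable
  finally have "emeasure (copula_measure ?C) {p \<in> unit_square. ?C p < \<psi> z} =
    emeasure (sample_space \<psi>) ((\<lambda>w. (first_margin w, second_margin w)) -` {p \<in> unit_square. ?C p < \<psi> z} \<inter> space (sample_space \<psi>))"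
    unfolding archimax_measure by (intro emeasure_distr margins_pair_measurable)
  also have "(\<lambda>w. (first_margin w, second_margin w)) -` {p \<in> unit_square. ?C p < \<psi> z} \<inter> space (sample_space \<psi>)
    = {w \<in> sample_set \<psi>. ?C (first_margin w, second_margin w) < \<psi> z}"
    using margins_range by (force simp: space_sample_space[OF \<psi> A])
  also have "emeasure (sample_space \<psi>) \<dots> = emeasure lborel {(x, p). x \<in> UNIV \<and> 0 < p \<and> p < h x}"
    unfolding set by (rule emeasure_sample_space[OF \<psi> A])
       (use emeasure_lborel_subgraph(1)[OF _ h, of UNIV] set in auto)
  also have "\<dots> = (\<integral>\<^sup>+x\<in>UNIV. ennreal (h x) \<partial>lborel)"
    by (rule emeasure_lborel_subgraph(2)) auto
  also have "\<dots> = (\<integral>\<^sup>+x. ennreal (cond_kernel \<psi> A x 0) * indicator {z<..} x +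
      ennreal (level_slope A (x / z) * ?g z) * indicator {0..z} x \<partial>lborel)"
  proof (rule nn_integral_cong)
    fix x show "ennreal (h x) * indicator UNIV x = ennreal (cond_kernel \<psi> A x 0) * indicator {z<..} x +
      ennreal (level_slope A (x / z) * ?g z) * indicator {0..z} x"
      using h_0[of x] z by (cases "0 \<le> x") (auto simp: cond_kernel_0[OF \<psi> A] h_def indicator_def)
  qed
  also have "\<dots> = (\<integral>\<^sup>+x. ennreal (cond_kernel \<psi> A x 0) * indicator {z<..} x \<partial>lborel) +
      (\<integral>\<^sup>+x. ennreal (level_slope A (x / z) * ?g z) * indicator {0..z} x \<partial>lborel)"
  proof (rule nn_integral_add)
    have "(\<lambda>x. ennreal (level_slope A (min 1 (x / z)) * ?g z) * indicator {0..z} x) \<in> borel_measurable lborel"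
      by measurable
    also have "(\<lambda>x. ennreal (level_slope A (min 1 (x / z)) * ?g z) * indicator {0..z} x) =
       (\<lambda>x. ennreal (level_slope A (x / z) * ?g z) * indicator {0..z} x)"
      using z by (auto simp: fun_eq_iff indicator_def min_def field_simps)
    finally show "(\<lambda>x. ennreal (level_slope A (x / z) * ?g z) * indicator {0..z} x) \<in> borel_measurable lborel" .
    show "(\<lambda>x. ennreal (cond_kernel \<psi> A x 0) * indicator {z<..} x) \<in> borel_measurable lborel"
      using borel_measurable_cond_kernel[OF \<psi> A order_refl] by measurable
  qed
  also have "(\<integral>\<^sup>+x. ennreal (cond_kernel \<psi> A x 0) * indicator {z<..} x \<partial>lborel) = ennreal (\<psi> z)"
    using cond_kernel_nn_integral[OF \<psi> A, of z 0] z by (simp add: stdf_0[OF A])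
  also have "(\<integral>\<^sup>+x. ennreal (level_slope A (x / z) * ?g z) * indicator {0..z} x \<partial>lborel) =
      ennreal (z * kendall_slope A * ?g z)"
    using level_slope_bounds(1)[OF A] z generator_density_nonneg[OF \<psi>]
    by (intro nn_integral_has_integral_lebesgue' has_integral_mult_left level_slope_has_integral[OF A]) auto
  also have "ennreal (\<psi> z) + ennreal (z * kendall_slope A * ?g z) =
      ennreal (\<psi> z + kendall_slope A * (z * ?g z))"
    using z kendall_slope_bounds[OF A] generator_density_nonneg[OF \<psi>, of z]
    by (subst ennreal_plus[symmetric]) (auto simp: mult_ac)
  finally show ?thesis
    using z kendall_slope_bounds[OF A] generator_density_nonneg[OF \<psi>, of z]
    by (simp add: kendall_strict_def measure_def del: ennreal_plus)
qed

lemma prob_space_archimax: "prob_space (copula_measure (archimax_copula \<psi> A))"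
proof -
  interpret prob_space "sample_space \<psi>" by (rule prob_space_sample_space[OF \<psi> A])
  show ?thesis unfolding archimax_measure by (rule prob_space_distr[OF margins_pair_measurable])
qed

lemma sets_archimax: "sets (copula_measure (archimax_copula \<psi> A)) = sets (restrict_space borel unit_square)"
  by (simp add: archimax_measure)

lemma space_archimax: "space (copula_measure (archimax_copula \<psi> A)) = unit_square"
  by (simp add: archimax_measure space_restrict_space)

lemma archimax_random_variable:
  "archimax_copula \<psi> A \<in> borel_measurable (copula_measure (archimax_copula \<psi> A))"
  using archimax_measurable measurable_cong_sets[OF sets_archimax refl] by blast

end

lemma archimedean_eq_archimax:
  assumes \<psi>: "\<psi> \<in> generators"
  shows "archimedean \<psi> = archimax_copula \<psi> (\<lambda>_. 1)"
proof (rule extensionalityI[of _ unit_square])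
  fix w :: "real \<times> real" assume "w \<in> unit_square"
  then obtain x y where w: "w = (x, y)" "x \<in> {0..1}" "y \<in> {0..1}" by auto
  show "archimedean \<psi> w = archimax_copula \<psi> (\<lambda>_. 1) w"
  proof (cases "x = 0 \<or> y = 0")
    case True
    hence "pseudo_inverse \<psi> 0 \<le> pseudo_inverse \<psi> x + pseudo_inverse \<psi> y" by (auto simp: add_increasing add_increasing2)
    hence "generator_ext \<psi> (pseudo_inverse \<psi> x + pseudo_inverse \<psi> y) = 0"
      by (rule generator_ext_beyond_zero[OF \<psi>])
    thus ?thesis using True w archimax_copula_eq[OF \<psi> independence_pickands w(2,3)]
      by (simp add: archimedean_def)
  next
    case False
    hence *: "pseudo_inverse \<psi> u = ennreal (generator_inv \<psi> u)" "0 \<le> generator_inv \<psi> u" if "u \<in> {x, y}" for u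
      using pseudo_inverse_eq[OF \<psi>, of u] generator_inv_nonneg[OF \<psi>, of u] w that by auto
    hence "pseudo_inverse \<psi> x + pseudo_inverse \<psi> y = ennreal (generator_inv \<psi> x + generator_inv \<psi> y)"
      by simp
    thus ?thesis
      using False w archimax_copula_eq[OF \<psi> independence_pickands w(2,3)] *
      by (simp add: archimedean_def generator_ext_def stdf_independence del: ennreal_plus)
  qed
qed (auto simp: archimedean_def archimax_copula_extensional[OF \<psi> independence_pickands])

lemma archimedean_copulaI:
  assumes "\<psi> \<in> generators"
  shows "archimedean_copula (archimedean \<psi>)"
  using assms archimax_is_copula[OF assms independence_pickands]
  by (auto simp: archimedean_copula_def archimedean_eq_archimax[OF assms, symmetric])

lemma kendall_strict_at:
  assumes \<psi>: "\<psi> \<in> generators" and A: "A \<in> pickands" and t: "t \<in> {0<..<1}"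
  shows "kendall_strict (archimax_copula \<psi> A) t =
    t + kendall_slope A * (generator_inv \<psi> t * generator_density \<psi> (generator_inv \<psi> t))"
  using kendall_strict_archimax[OF \<psi> A, of "generator_inv \<psi> t"] generator_generator_inv[OF \<psi>, of t]
    generator_inv_pos[OF \<psi>, of t] t by simp

section \<open>Kendall distributions from strict inequalities\<close>

lemma (in prob_space) prob_less_limit:
  fixes f :: "'a \<Rightarrow> real"
  assumes [measurable]: "f \<in> borel_measurable M" and "0 < t"
  shows "(\<lambda>n. prob {w \<in> space M. f w \<le> t - t / real (Suc n)}) \<longlonglongrightarrow> prob {w \<in> space M. f w < t}"
proof -
  define S where "S n = {w \<in> space M. f w \<le> t - t / real (Suc n)}" for n
  have "incseq S"
  proof (rule incseq_SucI)
    fix n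
    have "t / real (Suc (Suc n)) \<le> t / real (Suc n)" using \<open>0 < t\<close> by (intro divide_left_mono) auto
    thus "S n \<subseteq> S (Suc n)" unfolding S_def by force
  qed
  moreover have "(\<Union>n. S n) = {w \<in> space M. f w < t}"
  proof (intro equalityI subsetI)
    fix w assume w: "w \<in> {w \<in> space M. f w < t}"
    have "(\<lambda>n. t - t * (1 / real (Suc n))) \<longlonglongrightarrow> t - t * 0"
      by (intro tendsto_intros lim_1_over_n[THEN LIMSEQ_Suc])
    hence "eventually (\<lambda>n. f w < t - t * (1 / real (Suc n))) sequentially"
      using w by (intro order_tendstoD) auto
    then obtain n where "f w < t - t * (1 / real (Suc n))" by (auto simp: eventually_sequentially)
    hence "w \<in> S n" using w by (auto simp: S_def)
    thus "w \<in> (\<Union>n. S n)" by blast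
  next
    fix w assume "w \<in> (\<Union>n. S n)"
    then obtain n where n: "w \<in> space M" "f w \<le> t - t / real (Suc n)" by (auto simp: S_def)
    have "0 < t / real (Suc n)" using \<open>0 < t\<close> by simp
    thus "w \<in> {w \<in> space M. f w < t}" using n by auto
  qed
  moreover have "range S \<subseteq> sets M" by (auto simp: S_def)
  ultimately have "(\<lambda>n. prob (S n)) \<longlonglongrightarrow> prob {w \<in> space M. f w < t}"
    using finite_Lim_measure_incseq[of S] by simp
  thus ?thesis by (simp only: S_def)
qed

lemma (in prob_space) prob_le_limit:
  fixes f :: "'a \<Rightarrow> real"
  assumes [measurable]: "f \<in> borel_measurable M" and "0 < c"
  shows "(\<lambda>n. prob {w \<in> space M. f w < t + c / real (Suc n)}) \<longlonglongrightarrow> prob {w \<in> space M. f w \<le> t}"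
proof -
  define S where "S n = {w \<in> space M. f w < t + c / real (Suc n)}" for n
  have "decseq S"
  proof (rule decseq_SucI)
    fix n
    have "c / real (Suc (Suc n)) \<le> c / real (Suc n)" using \<open>0 < c\<close> by (intro divide_left_mono) auto
    thus "S (Suc n) \<subseteq> S n" unfolding S_def by force
  qed
  moreover have "(\<Inter>n. S n) = {w \<in> space M. f w \<le> t}"
  proof (intro equalityI subsetI)
    fix w assume "w \<in> (\<Inter>n. S n)"
    hence w: "w \<in> space M" "f w < t + c / real (Suc n)" for n by (auto simp: S_def)
    have "(\<lambda>n. t + c * (1 / real (Suc n))) \<longlonglongrightarrow> t + c * 0"
      by (intro tendsto_intros lim_1_over_n[THEN LIMSEQ_Suc])
    hence "f w \<le> t + c * 0"
      using w(2) by (intro LIMSEQ_le_const) (auto intro!: exI[of _ 0] less_imp_le)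
    thus "w \<in> {w \<in> space M. f w \<le> t}" using w by simp
  next
    fix w assume w: "w \<in> {w \<in> space M. f w \<le> t}"
    have "f w < t + c / real (Suc n)" for n
    proof -
      have "0 < c / real (Suc n)" using \<open>0 < c\<close> by simp
      thus ?thesis using w by auto
    qed
    thus "w \<in> (\<Inter>n. S n)" using w by (auto simp: S_def)
  qed
  moreover have "range S \<subseteq> sets M" by (auto simp: S_def)
  ultimately have "(\<lambda>n. prob (S n)) \<longlonglongrightarrow> prob {w \<in> space M. f w \<le> t}"
    using finite_Lim_measure_decseq[of S] by simp
  thus ?thesis by (simp only: S_def)
qed

text \<open>Each of the two distribution functions is a monotone limit of the other. Since \<open>t = 1\<close> is trivial for the
  closed version, only arguments inside \<open>(0, 1)\<close> matter for the strict one.\<close>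

lemma kendall_distribution_eq_iff:
  assumes 1: "\<psi>1 \<in> generators" "A1 \<in> pickands" and 2: "\<psi>2 \<in> generators" "A2 \<in> pickands"
  defines "C1 \<equiv> archimax_copula \<psi>1 A1" and "C2 \<equiv> archimax_copula \<psi>2 A2"
  shows "(\<forall>t\<in>{0..1}. kendall_distribution C1 t = kendall_distribution C2 t) \<longleftrightarrow>
         (\<forall>t\<in>{0<..<1}. kendall_strict C1 t = kendall_strict C2 t)"
proof -
  let ?M1 = "copula_measure C1" and ?M2 = "copula_measure C2"
  interpret P1: prob_space ?M1 unfolding C1_def by (rule prob_space_archimax[OF 1])
  interpret P2: prob_space ?M2 unfolding C2_def by (rule prob_space_archimax[OF 2])
  have sp: "space ?M1 = unit_square" "space ?M2 = unit_square"
    unfolding C1_def C2_def by (rule space_archimax[OF 1] space_archimax[OF 2])+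
  have rv: "C1 \<in> borel_measurable ?M1" "C2 \<in> borel_measurable ?M2"
    unfolding C1_def C2_def by (rule archimax_random_variable[OF 1] archimax_random_variable[OF 2])+
  have le1: "C w \<le> 1" if C: "is_copula C" and "w \<in> unit_square" for C w
  proof -
    obtain x y where "w = (x, y)" "x \<in> {0..1}" "y \<in> {0..1}" using \<open>w \<in> unit_square\<close> by auto
    moreover have "C (1, 1) = 1" using C unfolding is_copula_def by simp
    ultimately show ?thesis using copula_increment_bounds(1)[OF C, of x 1 y 1] by auto
  qed
  have cop: "is_copula C1" "is_copula C2"
    unfolding C1_def C2_def by (rule archimax_is_copula[OF 1] archimax_is_copula[OF 2])+
  show ?thesis
  proof safe
    fix t :: real assume eq: "\<forall>t\<in>{0..1}. kendall_distribution C1 t = kendall_distribution C2 t"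
      and t: "t \<in> {0<..<1}"
    have "t - t / real (Suc n) \<in> {0..1}" for n
    proof -
      have "t / real (Suc n) \<le> t" using t by (simp add: divide_le_eq)
      moreover have "0 \<le> t / real (Suc n)" using t by simp
      ultimately show ?thesis using t by (simp only: atLeastAtMost_iff greaterThanLessThan_iff) linarith
    qed
    hence *: "measure ?M1 {w \<in> space ?M1. C1 w \<le> t - t / real (Suc n)} =
        measure ?M2 {w \<in> space ?M2. C2 w \<le> t - t / real (Suc n)}" for n
      using eq unfolding kendall_distribution_def sp by blast
    show "kendall_strict C1 t = kendall_strict C2 t"
      using LIMSEQ_unique[OF P1.prob_less_limit[OF rv(1), of t, unfolded *] P2.prob_less_limit[OF rv(2), of t]] t
      by (simp add: kendall_strict_def sp)
  next
    fix t :: real assume eq: "\<forall>t\<in>{0<..<1}. kendall_strict C1 t = kendall_strict C2 t"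
      and t: "t \<in> {0..1}"
    show "kendall_distribution C1 t = kendall_distribution C2 t"
    proof (cases "t = 1")
      case True
      have "{w \<in> unit_square. C1 w \<le> t} = space ?M1" "{w \<in> unit_square. C2 w \<le> t} = space ?M2"
        using le1[OF cop(1)] le1[OF cop(2)] sp True by auto
      thus ?thesis by (simp only: kendall_distribution_def P1.prob_space P2.prob_space)
    next
      case False
      \<comment> \<open>Keeps \<open>t + c / Suc n\<close> below \<open>1\<close>.\<close>
      define c where "c = (1 - t) / 2"
      have c: "0 < c" "t + c < 1" using False t by (auto simp: c_def field_simps)
      have "t + c / real (Suc n) \<in> {0<..<1}" for n
      proof -
        have "c / real (Suc n) \<le> c" using c by (simp add: divide_le_eq)
        moreover have "0 < c / real (Suc n)" using c by simp
        ultimately show ?thesis using t c unfolding atLeastAtMost_iff greaterThanLessThan_iff by linarith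
      qed
      hence *: "measure ?M1 {w \<in> space ?M1. C1 w < t + c / real (Suc n)} =
          measure ?M2 {w \<in> space ?M2. C2 w < t + c / real (Suc n)}" for n
        using eq unfolding kendall_strict_def sp by blast
      show ?thesis
        using LIMSEQ_unique[OF P1.prob_le_limit[OF rv(1) c(1), of t, unfolded *] P2.prob_le_limit[OF rv(2) c(1), of t]]
        by (simp add: kendall_distribution_def sp)
    qed
  qed
qed

section \<open>Kendall's tau of an extreme-value copula\<close>

text \<open>The generator for which the Archimax copula is the extreme-value copula, with \<open>\<phi> t = - log 2 t\<close>.\<close>

definition exponential_generator :: "real \<Rightarrow> real" where
  "exponential_generator z = 2 powr (- z)"

lemma exponential_generator_has_derivative:
  "(exponential_generator has_real_derivative - ln 2 * exponential_generator z) (at z)"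
  unfolding exponential_generator_def[abs_def]
  by (auto intro!: derivative_eq_intros simp: powr_minus)

lemma exponential_generator_convex: "convex_on UNIV exponential_generator"
proof (rule f''_ge0_imp_convex)
  fix z
  show "(exponential_generator has_real_derivative - ln 2 * exponential_generator z) (at z)"
    by (rule exponential_generator_has_derivative)
  show "((\<lambda>z. - ln 2 * exponential_generator z) has_real_derivative - ln 2 * (- ln 2 * exponential_generator z)) (at z)"
    by (rule DERIV_cmult[OF exponential_generator_has_derivative])
  show "0 \<le> - ln 2 * (- ln 2 * exponential_generator z)"
    by (simp add: exponential_generator_def)
qed simp

lemma exponential_generator_in_generators: "exponential_generator \<in> generators"
proof (rule generatorsI)
  show "continuous_on {0..} exponential_generator"
    unfolding exponential_generator_def[abs_def] by (intro continuous_intros) auto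
  show "convex_on {0..} exponential_generator"
    by (rule convex_on_subset[OF exponential_generator_convex]) auto
  show "(exponential_generator \<longlongrightarrow> 0) at_top"
  proof -
    have "((\<lambda>z. exp (- ln 2 * z)) \<longlongrightarrow> (0::real)) at_top"
      by (intro filterlim_compose[OF exp_at_bot] filterlim_tendsto_neg_mult_at_bot[OF tendsto_const _ filterlim_ident]) simp
    thus ?thesis by (simp add: exponential_generator_def[abs_def] powr_def mult.commute)
  qed
  show "0 \<le> exponential_generator z \<and> exponential_generator z \<le> 1" if "0 \<le> z" for z
    using that powr_mono[of "- z" 0 2] by (simp add: exponential_generator_def)
  show "exponential_generator y \<le> exponential_generator x" if "x \<le> y" for x y
    using that powr_mono[of "- y" "- x" 2] by (simp add: exponential_generator_def)
qed (simp_all add: exponential_generator_def powr_minus)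

lemma exponential_generator_density:
  "0 < z \<Longrightarrow> generator_density exponential_generator z = ln 2 * exponential_generator z"
  using right_slope_eqI[OF generator_convex[OF exponential_generator_in_generators] _
      DERIV_tendsto_at_right[OF exponential_generator_has_derivative]]
  by (simp add: generator_density_def)

lemma exponential_generator_log: "0 < t \<Longrightarrow> exponential_generator (- log 2 t) = t"
  by (simp add: exponential_generator_def)

lemma extreme_value_eq_archimax:
  "extreme_value_copula A = archimax_copula exponential_generator A"
proof -
  have inv: "enn2real (pseudo_inverse exponential_generator x) = - log 2 x" if "x \<in> {0<..<1}" for x
    using generator_inv_eq[OF exponential_generator_in_generators, of "- log 2 x"] that
    by (simp add: exponential_generator_log generator_inv_def)
  show ?thesis
    unfolding extreme_value_copula_def archimax_copula_def copula_extension_def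
  proof (intro restrict_ext, clarsimp simp: Let_def)
    fix x y :: real assume "x \<noteq> 0" "y \<noteq> 0" "0 \<le> x" "x \<le> 1" "0 \<le> y" "y \<le> 1" "x \<noteq> 1" "y \<noteq> 1"
    hence xy: "x \<in> {0<..<1}" "y \<in> {0<..<1}" by auto
    let ?a = "- log 2 x" and ?b = "- log 2 y"
    have pos: "0 < x * y" using xy by simp
    have sum: "?a + ?b = - log 2 (x * y)" using xy by (simp add: log_mult)
    have "?a / (?a + ?b) = ln x / ln (x * y)" unfolding sum by (simp add: log_def)
    hence "exponential_generator ((?a + ?b) * A (?a / (?a + ?b))) =
        2 powr (log 2 (x * y) * A (ln x / ln (x * y)))"
      unfolding sum exponential_generator_def by simp
    also have "\<dots> = (x * y) powr A (ln x / ln (x * y))"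
      using pos by (simp add: powr_powr[symmetric])
    finally show "(x * y) powr A (ln x / ln (x * y)) =
      exponential_generator ((enn2real (pseudo_inverse exponential_generator x) + enn2real (pseudo_inverse exponential_generator y)) *
        A (enn2real (pseudo_inverse exponential_generator x) /
          (enn2real (pseudo_inverse exponential_generator x) + enn2real (pseudo_inverse exponential_generator y))))"
      unfolding inv[OF xy(1)] inv[OF xy(2)] by simp
  qed
qed

lemma (in prob_space) expectation_layer_cake:
  fixes f :: "'a \<Rightarrow> real"
  assumes [measurable]: "f \<in> borel_measurable M" and range: "\<And>w. w \<in> space M \<Longrightarrow> 0 \<le> f w \<and> f w \<le> 1"
  shows "(\<integral>\<^sup>+w. ennreal (f w) \<partial>M) = (\<integral>\<^sup>+t\<in>{0<..<1}. ennreal (1 - prob {w \<in> space M. f w < t}) \<partial>lborel)"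
proof -
  interpret pair_sigma_finite lborel M ..
  let ?I = "\<lambda>(t, w). indicator {(t, w). 0 < t \<and> t < 1 \<and> t \<le> f w} (t, w) :: ennreal"
  have meas: "?I \<in> borel_measurable (lborel \<Otimes>\<^sub>M M)"
  proof -
    have "{p \<in> space (lborel \<Otimes>\<^sub>M M). 0 < fst p \<and> fst p < 1 \<and> fst p \<le> f (snd p)} \<in> sets (lborel \<Otimes>\<^sub>M M)"
      by measurable
    hence "(indicator {p \<in> space (lborel \<Otimes>\<^sub>M M). 0 < fst p \<and> fst p < 1 \<and> fst p \<le> f (snd p)} :: _ \<Rightarrow> ennreal)
       \<in> borel_measurable (lborel \<Otimes>\<^sub>M M)" by simp
    thus ?thesis
      by (rule measurable_cong[THEN iffD1, rotated]) (auto simp: indicator_def)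
  qed
  have "(\<integral>\<^sup>+w. ennreal (f w) \<partial>M) = (\<integral>\<^sup>+w. (\<integral>\<^sup>+t. ?I (t, w) \<partial>lborel) \<partial>M)"
  proof (rule nn_integral_cong)
    fix w assume w: "w \<in> space M"
    have eq: "?I (t, w) = indicator {t. 0 < t \<and> t < 1 \<and> t \<le> f w} t" for t by (simp add: indicator_def)
    \<comment> \<open>The upper bound on \<open>f\<close> makes it possible to integrate over \<open>t < 1\<close> only.\<close>
    have "{t. 0 < t \<and> t < 1 \<and> t \<le> f w} = (if f w < 1 then {0<..f w} else {0<..<1})"
      using range[OF w] by auto
    hence "emeasure lborel {t. 0 < t \<and> t < 1 \<and> t \<le> f w} = ennreal (f w)"
      "{t. 0 < t \<and> t < 1 \<and> t \<le> f w} \<in> sets lborel"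
      using range[OF w] by auto
    thus "ennreal (f w) = (\<integral>\<^sup>+t. ?I (t, w) \<partial>lborel)" unfolding eq by simp
  qed
  also have "\<dots> = (\<integral>\<^sup>+t. (\<integral>\<^sup>+w. ?I (t, w) \<partial>M) \<partial>lborel)"
    by (rule Fubini[OF meas])
  also have "\<dots> = (\<integral>\<^sup>+t\<in>{0<..<1}. ennreal (1 - prob {w \<in> space M. f w < t}) \<partial>lborel)"
  proof (rule nn_integral_cong)
    fix t :: real
    show "(\<integral>\<^sup>+w. ?I (t, w) \<partial>M) = ennreal (1 - prob {w \<in> space M. f w < t}) * indicator {0<..<1} t"
    proof (cases "t \<in> {0<..<1}")
      case True
      have "(\<integral>\<^sup>+w. ?I (t, w) \<partial>M) = (\<integral>\<^sup>+w. indicator {w \<in> space M. t \<le> f w} w \<partial>M)"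
        using True by (intro nn_integral_cong) (auto simp: indicator_def)
      also have "\<dots> = ennreal (prob {w \<in> space M. t \<le> f w})"
        by (simp add: emeasure_eq_measure)
      also have "{w \<in> space M. t \<le> f w} = space M - {w \<in> space M. f w < t}" by auto
      also have "prob \<dots> = 1 - prob {w \<in> space M. f w < t}" by (rule prob_compl) measurable
      finally show ?thesis using True by simp
    next
      case False
      have "(\<integral>\<^sup>+w. ?I (t, w) \<partial>M) = (\<integral>\<^sup>+w. 0 \<partial>M)"
        using False by (intro nn_integral_cong) (auto simp: indicator_def)
      thus ?thesis using False by simp
    qed
  qed
  finally show ?thesis .
qed

lemma xlnx_bound:
  assumes "0 \<le> (t::real)" "t \<le> 1"
  shows "\<bar>t * ln t\<bar> \<le> 1"
proof (cases "t = 0")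
  case False
  hence t: "0 < t" using assms by simp
  have "- ln t \<le> 1 / t - 1" using ln_le_minus_one[of "1 / t"] t by (simp add: ln_div)
  hence "t * (- ln t) \<le> t * (1 / t - 1)" using t by (intro mult_left_mono) auto
  hence "- (t * ln t) \<le> 1" using t by (simp add: right_diff_distrib)
  moreover have "t * ln t \<le> 0" using t assms by (intro mult_nonneg_nonpos) auto
  ultimately show ?thesis by simp
qed simp

lemma has_integral_entropy:
  "((\<lambda>t::real. 1 - (t - k * (t * ln t))) has_integral (1 / 2 - k / 4)) {0..1}"
proof -
  let ?F = "\<lambda>t::real. t - t\<^sup>2 / 2 + k * (t * (t * ln t) / 2 - t\<^sup>2 / 4)"
  have "((\<lambda>t::real. 1 - (t - k * (t * ln t))) has_integral (?F 1 - ?F 0)) {0..1}"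
  proof (rule fundamental_theorem_of_calculus_interior)
    fix t :: real assume t: "t \<in> {0<..<1}"
    show "(?F has_vector_derivative 1 - (t - k * (t * ln t))) (at t)"
      unfolding has_real_derivative_iff_has_vector_derivative[symmetric]
      using t by (auto intro!: derivative_eq_intros simp: field_simps power2_eq_square)
  next
    have lim: "continuous (at t within {0..1}) (\<lambda>t. t * (t * ln t))" if t: "t \<in> {0..1}" for t :: real
    proof (cases "t = 0")
      case True
      have "((\<lambda>t::real. t * (t * ln t)) \<longlongrightarrow> 0) (at 0 within {0..1})"
      proof (rule Lim_null_comparison)
        have "norm (t * (t * ln t)) \<le> \<bar>t\<bar>" if "t \<in> {0..1}" for t :: real
          using mult_left_mono[OF xlnx_bound[of t], of "\<bar>t\<bar>"] that by (simp add: abs_mult)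
        thus "eventually (\<lambda>t. norm (t * (t * ln t)) \<le> \<bar>t\<bar>) (at 0 within {0..1::real})"
          unfolding eventually_at_filter by (intro always_eventually) blast
        show "((\<lambda>t::real. \<bar>t\<bar>) \<longlongrightarrow> 0) (at 0 within {0..1})"
          by (auto intro!: tendsto_eq_intros)
      qed
      thus ?thesis using True by (simp add: continuous_within)
    next
      case False
      thus ?thesis using t by (intro continuous_intros) auto
    qed
    define h where "h t = t * (t * ln t)" for t :: real
    have "continuous_on {0..1} h" using lim by (simp add: continuous_on_eq_continuous_within h_def[abs_def])
    hence "continuous_on {0..1} (\<lambda>t. t - t\<^sup>2 / 2 + k * (h t / 2 - t\<^sup>2 / 4))" by (intro continuous_intros) auto
    thus "continuous_on {0..1} ?F" by (simp only: h_def)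
  qed simp
  thus ?thesis by (simp add: algebra_simps)
qed

text \<open>The strict Kendall distribution is \<open>t - \<kappa> t ln t\<close>, so the mean of the copula under its own law is
  \<open>1/2 - \<kappa>/4\<close>.\<close>

lemma kendall_tau_extreme_value:
  assumes A: "A \<in> pickands"
  shows "kendall_tau (extreme_value_copula A) = 1 - kendall_slope A"
proof -
  let ?\<psi> = exponential_generator
  let ?C = "archimax_copula ?\<psi> A"
  let ?M = "copula_measure ?C"
  let ?k = "kendall_slope A"
  note gen = exponential_generator_in_generators
  interpret prob_space ?M by (rule prob_space_archimax[OF gen A])
  have strict: "kendall_strict ?C t = t - ?k * (t * ln t)" if t: "t \<in> {0<..<1}" for t
  proof -
    have z: "0 < - log 2 t" "?\<psi> (- log 2 t) = t" using t exponential_generator_log[of t] by auto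
    show ?thesis
      using kendall_strict_archimax[OF gen A z(1)] exponential_generator_density[OF z(1)] t
      unfolding z(2) by (simp add: log_def)
  qed
  have cop: "is_copula ?C" by (rule archimax_is_copula[OF gen A])
  have sp: "space ?M = unit_square" by (rule space_archimax[OF gen A])
  have range: "0 \<le> ?C w \<and> ?C w \<le> 1" if space: "w \<in> space ?M" for w
  proof -
    obtain x y where w: "w = (x, y)" "x \<in> {0..1}" "y \<in> {0..1}" using space sp by auto
    moreover have "?C (1, 1) = 1" "?C (0, 0) = 0" using cop unfolding is_copula_def by simp_all
    ultimately show ?thesis
      using copula_increment_bounds(1)[OF cop, of x 1 y 1] copula_increment_bounds(1)[OF cop, of 0 x 0 y] by auto
  qed
  have "(\<integral>\<^sup>+w. ennreal (?C w) \<partial>?M) = (\<integral>\<^sup>+t\<in>{0<..<1}. ennreal (1 - kendall_strict ?C t) \<partial>lborel)"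
    using expectation_layer_cake[OF archimax_random_variable[OF gen A] range]
    unfolding kendall_strict_def sp .
  also have "\<dots> = (\<integral>\<^sup>+t. ennreal (1 - (t - ?k * (t * ln t))) * indicator {0<..<1} t \<partial>lborel)"
    using strict by (intro nn_integral_cong) (auto simp: indicator_def)
  also have "\<dots> = ennreal (1 / 2 - ?k / 4)"
  proof (rule nn_integral_has_integral_lebesgue')
    show "0 \<le> 1 - (t - ?k * (t * ln t))" if "t \<in> {0<..<1}" for t
      unfolding strict[OF that, symmetric] by (simp add: kendall_strict_def)
    show "((\<lambda>t. 1 - (t - ?k * (t * ln t))) has_integral 1 / 2 - ?k / 4) {0<..<1}"
      using has_integral_entropy[of ?k] has_integral_Icc_iff_Ioo by blast
  qed
  finally have "(\<integral>w. ?C w \<partial>?M) = 1 / 2 - ?k / 4"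
    using kendall_slope_bounds[OF A] range archimax_random_variable[OF gen A]
    by (subst integral_eq_nn_integral) auto
  thus ?thesis by (simp add: kendall_tau_def extreme_value_eq_archimax)
qed

section \<open>Powers of a generator\<close>

text \<open>For positive \<open>x\<close> and \<open>y\<close> this is convexity of \<open>z powr (1 / \<alpha>)\<close> at \<open>x powr \<alpha>\<close> and \<open>y powr \<alpha>\<close>.\<close>

lemma powr_concave:
  fixes x y t \<alpha> :: real
  assumes "0 < \<alpha>" "\<alpha> \<le> 1" "0 \<le> x" "0 \<le> y" "0 \<le> t" "t \<le> 1"
  shows "(1 - t) * x powr \<alpha> + t * y powr \<alpha> \<le> ((1 - t) * x + t * y) powr \<alpha>"
proof -
  have scale: "s * z powr \<alpha> \<le> (s * z) powr \<alpha>" if "0 \<le> s" "s \<le> 1" "0 \<le> z" for s z :: real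
  proof (cases "s = 0")
    case False
    have "s powr 1 \<le> s powr \<alpha>" using that assms False by (intro powr_mono') auto
    thus ?thesis using that False by (simp add: powr_mult mult_right_mono)
  qed simp
  consider "x = 0" | "y = 0" | "0 < x" "0 < y" using assms by fastforce
  thus ?thesis
  proof cases
    case 3
    let ?u = "x powr \<alpha>" and ?v = "y powr \<alpha>"
    have "((1 - t) *\<^sub>R ?u + t *\<^sub>R ?v) powr (1 / \<alpha>) \<le> (1 - t) * ?u powr (1 / \<alpha>) + t * ?v powr (1 / \<alpha>)"
      using assms 3 by (intro convex_onD[OF powr_convex]) auto
    also have "\<dots> = (1 - t) * x + t * y"
      using assms 3 by (simp add: powr_powr)
    finally have "(((1 - t) * ?u + t * ?v) powr (1 / \<alpha>)) powr \<alpha> \<le> ((1 - t) * x + t * y) powr \<alpha>"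
      using assms by (intro powr_mono2) auto
    thus ?thesis using assms by (simp add: powr_powr)
  qed (use scale[of t y] scale[of "1 - t" x] assms in auto)
qed

lemma generator_power_in_generators:
  assumes \<psi>: "\<psi> \<in> generators" and \<alpha>: "0 < \<alpha>" "\<alpha> \<le> 1"
  shows "generator_power \<psi> \<alpha> \<in> generators"
proof (rule generatorsI)
  show "continuous_on {0..} (generator_power \<psi> \<alpha>)"
    unfolding generator_power_def using \<alpha>
    by (intro continuous_on_compose2[OF generator_continuous[OF \<psi>]] continuous_on_powr' continuous_intros) auto
  show "convex_on {0..} (generator_power \<psi> \<alpha>)"
  proof (rule convex_onI)
    fix t x y :: real assume t: "0 < t" "t < 1" and xy: "x \<in> {0..}" "y \<in> {0..}"
    have cv: "convex_on {0..} \<psi>" using \<psi> by (simp add: generators_def)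
    have "\<psi> (((1 - t) * x + t * y) powr \<alpha>) \<le> \<psi> ((1 - t) * x powr \<alpha> + t * y powr \<alpha>)"
      using t xy \<alpha> by (intro generator_antimono[OF \<psi>] powr_concave) auto
    also have "\<dots> \<le> (1 - t) * \<psi> (x powr \<alpha>) + t * \<psi> (y powr \<alpha>)"
      using convex_onD[OF cv, of t "x powr \<alpha>" "y powr \<alpha>"] t by simp
    finally show "generator_power \<psi> \<alpha> ((1 - t) *\<^sub>R x + t *\<^sub>R y) \<le>
        (1 - t) * generator_power \<psi> \<alpha> x + t * generator_power \<psi> \<alpha> y"
      by (simp add: generator_power_def)
  qed simp
  have "filterlim (\<lambda>z. z powr \<alpha>) at_top at_top"
    unfolding filterlim_at_top
  proof
    fix Z :: real
    show "eventually (\<lambda>z. Z \<le> z powr \<alpha>) at_top"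
      using eventually_ge_at_top[of "max 1 Z powr (1 / \<alpha>)"]
    proof eventually_elim
      case (elim z)
      have "(max 1 Z powr (1 / \<alpha>)) powr \<alpha> \<le> z powr \<alpha>" using elim \<alpha> by (intro powr_mono2) auto
      thus ?case using \<alpha> by (simp add: powr_powr)
    qed
  qed
  thus "(generator_power \<psi> \<alpha> \<longlongrightarrow> 0) at_top"
    unfolding generator_power_def by (rule filterlim_compose[OF generator_tendsto_0[OF \<psi>]])
  show "generator_power \<psi> \<alpha> y \<le> generator_power \<psi> \<alpha> x" if "0 \<le> x" "x \<le> y" for x y
    unfolding generator_power_def using that \<alpha> by (intro generator_antimono[OF \<psi>] powr_mono2) auto
qed (use generator_bounds[OF \<psi>] generator_0[OF \<psi>] generator_1[OF \<psi>] in \<open>auto simp: generator_power_def\<close>)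

text \<open>The chain rule for right derivatives, applicable because \<open>z powr \<alpha>\<close> is increasing.\<close>

lemma generator_power_density:
  assumes \<psi>: "\<psi> \<in> generators" and \<alpha>: "0 < \<alpha>" "\<alpha> \<le> 1" and z: "0 < z"
  shows "z * generator_density (generator_power \<psi> \<alpha>) z = \<alpha> * (z powr \<alpha> * generator_density \<psi> (z powr \<alpha>))"
proof -
  let ?P = "generator_power \<psi> \<alpha>" and ?p = "\<lambda>t::real. t powr \<alpha>"
  have mono: "?p s < ?p t" if "0 < s" "s < t" for s t
    using that \<alpha> by (intro powr_less_mono2) auto
  have der: "(?p has_real_derivative \<alpha> * z powr (\<alpha> - 1)) (at z)"
    using z by (auto intro!: derivative_eq_intros)
  have "filterlim ?p (at_right (?p z)) (at_right z)"
    unfolding filterlim_at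
  proof
    show "eventually (\<lambda>t. ?p t \<in> {?p z<..} \<and> ?p t \<noteq> ?p z) (at_right z)"
      using mono[OF z] by (intro eventually_at_rightI[of z "z + 1"]) force+
    have "isCont ?p z" by (rule DERIV_isCont[OF der])
    thus "(?p \<longlongrightarrow> ?p z) (at_right z)"
      unfolding isCont_def by (rule filterlim_mono) (auto intro: at_le)
  qed
  from filterlim_compose[OF right_slope_tendsto[OF generator_convex[OF \<psi>]] this]
  have "((\<lambda>t. (\<psi> (?p t) - \<psi> (?p z)) / (?p t - ?p z)) \<longlongrightarrow> right_slope \<psi> (?p z)) (at_right z)"
    using z by simp
  hence "((\<lambda>t. (\<psi> (?p t) - \<psi> (?p z)) / (?p t - ?p z) * ((?p t - ?p z) / (t - z)))
      \<longlongrightarrow> right_slope \<psi> (?p z) * (\<alpha> * z powr (\<alpha> - 1))) (at_right z)"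
    by (rule tendsto_mult[OF _ DERIV_tendsto_at_right[OF der]])
  moreover have "eventually (\<lambda>t. (\<psi> (?p t) - \<psi> (?p z)) / (?p t - ?p z) * ((?p t - ?p z) / (t - z)) =
      (?P t - ?P z) / (t - z)) (at_right z)"
  proof (rule eventually_at_rightI[of z "z + 1"])
    fix t assume "t \<in> {z<..<z + 1}"
    hence "?p t - ?p z \<noteq> 0" using mono[OF z, of t] by simp
    thus "(\<psi> (?p t) - \<psi> (?p z)) / (?p t - ?p z) * ((?p t - ?p z) / (t - z)) = (?P t - ?P z) / (t - z)"
      by (simp add: generator_power_def)
  qed simp
  ultimately have "((\<lambda>t. (?P t - ?P z) / (t - z)) \<longlongrightarrow> right_slope \<psi> (?p z) * (\<alpha> * z powr (\<alpha> - 1))) (at_right z)"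
    by (rule Lim_transform_eventually)
  hence "right_slope ?P z = right_slope \<psi> (?p z) * (\<alpha> * z powr (\<alpha> - 1))"
    by (rule right_slope_eqI[OF generator_convex[OF generator_power_in_generators[OF \<psi> \<alpha>]] z])
  moreover have "z * z powr (\<alpha> - 1) = z powr \<alpha>"
    using z by (simp add: powr_diff)
  ultimately show ?thesis
    using z by (simp add: generator_density_def)
qed

lemma kendall_strict_generator_power:
  assumes \<psi>: "\<psi> \<in> generators" and A: "A \<in> pickands" and pos: "0 < kendall_slope A" and t: "t \<in> {0<..<1}"
  shows "kendall_strict (archimedean (generator_power \<psi> (kendall_slope A))) t =
    kendall_strict (archimax_copula \<psi> A) t"
proof -
  let ?\<alpha> = "kendall_slope A" and ?w = "generator_inv \<psi> t"
  let ?P = "generator_power \<psi> ?\<alpha>"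
  have \<alpha>: "0 < ?\<alpha>" "?\<alpha> \<le> 1" using pos kendall_slope_bounds[OF A] by auto
  note P = generator_power_in_generators[OF \<psi> \<alpha>]
  have w: "0 < ?w" "\<psi> ?w = t" using generator_inv_pos[OF \<psi>] generator_generator_inv[OF \<psi>] t by auto
  define z where "z = ?w powr (1 / ?\<alpha>)"
  have z: "0 < z" "z powr ?\<alpha> = ?w" using w \<alpha> by (auto simp: z_def powr_powr)
  have "?P z = t" using z w by (simp add: generator_power_def)
  hence "generator_inv ?P t = z" using generator_inv_eq[OF P, of z] z t by simp
  hence "kendall_strict (archimedean ?P) t = t + z * generator_density ?P z"
    using kendall_strict_at[OF P independence_pickands t]
    by (simp add: archimedean_eq_archimax[OF P] kendall_slope_independence)
  also have "\<dots> = t + ?\<alpha> * (?w * generator_density \<psi> ?w)"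
    using generator_power_density[OF \<psi> \<alpha> z(1)] z(2) by simp
  also have "\<dots> = kendall_strict (archimax_copula \<psi> A) t"
    using kendall_strict_at[OF \<psi> A t] by simp
  finally show ?thesis .
qed

section \<open>Uniqueness of the Archimedean copula\<close>

text \<open>The inverse \<open>\<phi>\<close> has slopes between \<open>- 1 / g (\<phi> t)\<close> and \<open>- 1 / g (\<phi> s)\<close> on \<open>[t, s]\<close>, and the logarithm multiplies
  them by a factor between \<open>1 / \<phi> t\<close> and \<open>1 / \<phi> s\<close>. So \<open>u * w\<close> plays the part of \<open>- (ln \<phi>)'\<close>.\<close>

lemma log_generator_inv_increment:
  assumes \<psi>: "\<psi> \<in> generators" and ts: "0 < t" "t \<le> s" "s < 1"
  defines "\<phi> \<equiv> generator_inv \<psi>"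
  defines "u \<equiv> \<lambda>t. 1 / generator_density \<psi> (\<phi> t)" and "w \<equiv> \<lambda>t. 1 / \<phi> t"
  shows "0 < u s" "u s \<le> u t" "0 < w t" "w t \<le> w s"
    and "u s * w t * (s - t) \<le> ln (\<phi> t) - ln (\<phi> s)"
    and "ln (\<phi> t) - ln (\<phi> s) \<le> u t * w s * (s - t)"
proof -
  let ?g = "generator_density \<psi>"
  have pos: "0 < \<phi> t" "0 < \<phi> s" and le: "\<phi> s \<le> \<phi> t" and inv: "\<psi> (\<phi> t) = t" "\<psi> (\<phi> s) = s"
    using generator_inv_pos[OF \<psi>] generator_inv_antimono[OF \<psi>] generator_generator_inv[OF \<psi>] ts
    by (auto simp: \<phi>_def)
  have g: "0 < ?g (\<phi> t)" "0 < ?g (\<phi> s)" "?g (\<phi> t) \<le> ?g (\<phi> s)"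
    using generator_density_pos_iff[OF \<psi>] generator_density_antimono[OF \<psi>] pos le inv ts by auto
  show "0 < u s" "u s \<le> u t" "0 < w t" "w t \<le> w s"
    using g pos le by (auto simp: u_def w_def frac_le)
  have inc: "?g (\<phi> t) * (\<phi> t - \<phi> s) \<le> s - t" "s - t \<le> ?g (\<phi> s) * (\<phi> t - \<phi> s)"
    using generator_density_bounds[OF \<psi> pos(2) le] inv by auto
  have "u s * w t * (s - t) \<le> u s * w t * (?g (\<phi> s) * (\<phi> t - \<phi> s))"
    using inc(2) \<open>0 < u s\<close> \<open>0 < w t\<close> by (intro mult_left_mono) auto
  also have "\<dots> = - ((\<phi> s - \<phi> t) / \<phi> t)"
    using g pos by (simp add: u_def w_def field_simps)
  also have "\<dots> \<le> ln (\<phi> t) - ln (\<phi> s)" using ln_diff_le[OF pos(2,1)] by simp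
  finally show "u s * w t * (s - t) \<le> ln (\<phi> t) - ln (\<phi> s)" .
  have "ln (\<phi> t) - ln (\<phi> s) \<le> (\<phi> t - \<phi> s) / \<phi> s" by (rule ln_diff_le[OF pos])
  also have "\<dots> = u t * w s * (?g (\<phi> t) * (\<phi> t - \<phi> s))"
    using g pos by (simp add: u_def w_def)
  also have "\<dots> \<le> u t * w s * (s - t)"
    using inc(1) \<open>0 < u s\<close> \<open>u s \<le> u t\<close> \<open>0 < w t\<close> \<open>w t \<le> w s\<close> by (intro mult_left_mono) auto
  finally show "ln (\<phi> t) - ln (\<phi> s) \<le> u t * w s * (s - t)" .
qed

text \<open>By hypothesis \<open>u * w\<close> is the same for both generators. The increments of \<open>ln \<phi>\<close> for both are thus close to the
  same number, with an error controlled by increments of monotone functions; hence the logarithms differ by a constant,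
  which is \<open>0\<close> at \<open>t = 1/2\<close>.\<close>

lemma generator_inv_unique:
  assumes 1: "\<psi>1 \<in> generators" and 2: "\<psi>2 \<in> generators"
    and eq: "\<And>t. t \<in> {0<..<1} \<Longrightarrow> generator_inv \<psi>1 t * generator_density \<psi>1 (generator_inv \<psi>1 t) =
                                generator_inv \<psi>2 t * generator_density \<psi>2 (generator_inv \<psi>2 t)"
    and t: "t \<in> {0<..<1}"
  shows "generator_inv \<psi>1 t = generator_inv \<psi>2 t"
proof -
  define D where "D t = ln (generator_inv \<psi>1 t) - ln (generator_inv \<psi>2 t)" for t
  define u w where "u \<psi> t = 1 / generator_density \<psi> (generator_inv \<psi> t)" and "w \<psi> t = 1 / generator_inv \<psi> t" for \<psi> t
  have const: "D q = D p" if pq: "0 < p" "p \<le> q" "q < 1" for p q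
  proof -
    define B where "B \<psi> x = u \<psi> p * w \<psi> x - w \<psi> q * u \<psi> x" for \<psi> x
    have gap: "u \<psi> x * w \<psi> y - u \<psi> y * w \<psi> x \<le> B \<psi> y - B \<psi> x"
      if \<psi>: "\<psi> \<in> generators" and xy: "p \<le> x" "x \<le> y" "y \<le> q" for \<psi> x y
    proof -
      note m = log_generator_inv_increment(1-4)[OF \<psi>, folded u_def w_def]
      have "u \<psi> x * w \<psi> y - u \<psi> y * w \<psi> x = (u \<psi> x - u \<psi> y) * w \<psi> y + u \<psi> y * (w \<psi> y - w \<psi> x)"
        by (simp add: algebra_simps)
      also have "\<dots> \<le> (u \<psi> x - u \<psi> y) * w \<psi> q + u \<psi> p * (w \<psi> y - w \<psi> x)"
        using m[of x y] m[of y q] m[of p y] xy pq by (intro add_mono mult_left_mono mult_right_mono) auto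
      finally show ?thesis by (simp add: B_def algebra_simps)
    qed
    show ?thesis
    proof (rule constant_if_increments_small[where B = "\<lambda>x. B \<psi>1 x + B \<psi>2 x", OF pq(2)])
      fix x y assume xy: "p \<le> x" "x \<le> y" "y \<le> q"
      \<comment> \<open>The common value of \<open>- (ln \<phi>)'\<close>; it lies between the bounds for either generator.\<close>
      define L where "L = u \<psi>1 y * w \<psi>1 y"
      have L: "L = u \<psi>2 y * w \<psi>2 y"
        unfolding L_def u_def w_def using eq[of y] xy pq by (simp add: mult.commute)
      have *: "\<bar>ln (generator_inv \<psi> x) - ln (generator_inv \<psi> y) - L * (y - x)\<bar> \<le> (B \<psi> y - B \<psi> x) * (y - x)"
        if \<psi>: "\<psi> \<in> generators" and L: "L = u \<psi> y * w \<psi> y" for \<psi>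
      proof -
        have 0: "0 < x" "y < 1" using xy pq by auto
        note m = log_generator_inv_increment[OF \<psi> 0(1) xy(2) 0(2), folded u_def w_def]
        have "u \<psi> y * w \<psi> x \<le> L" "L \<le> u \<psi> x * w \<psi> y"
          unfolding L using m(1-4) by (auto intro!: mult_left_mono mult_right_mono)
        hence "u \<psi> y * w \<psi> x * (y - x) \<le> L * (y - x)" "L * (y - x) \<le> u \<psi> x * w \<psi> y * (y - x)"
          using xy by (auto intro!: mult_right_mono)
        hence "\<bar>ln (generator_inv \<psi> x) - ln (generator_inv \<psi> y) - L * (y - x)\<bar> \<le>
            (u \<psi> x * w \<psi> y - u \<psi> y * w \<psi> x) * (y - x)"
          using m(5,6) unfolding left_diff_distrib by linarith
        also have "\<dots> \<le> (B \<psi> y - B \<psi> x) * (y - x)"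
          using gap[OF \<psi> xy] xy by (intro mult_right_mono) auto
        finally show ?thesis .
      qed
      have "\<bar>D y - D x\<bar> \<le> (B \<psi>1 y - B \<psi>1 x) * (y - x) + (B \<psi>2 y - B \<psi>2 x) * (y - x)"
        using *[OF 1 L_def] *[OF 2 L] unfolding D_def by linarith
      thus "\<bar>D y - D x\<bar> \<le> (y - x) * (B \<psi>1 y + B \<psi>2 y - (B \<psi>1 x + B \<psi>2 x))"
        by (simp add: algebra_simps)
    qed
  qed
  have "generator_inv \<psi> (1 / 2) = 1" if "\<psi> \<in> generators" for \<psi>
    using generator_inv_eq[OF that, of 1] generator_1[OF that] by simp
  hence "D (1 / 2) = 0" using 1 2 by (simp add: D_def)
  moreover have "D t = D (1 / 2)"
    using const[of t "1 / 2"] const[of "1 / 2" t] t by (cases "t \<le> 1 / 2") auto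
  ultimately have "ln (generator_inv \<psi>1 t) = ln (generator_inv \<psi>2 t)" by (simp add: D_def)
  thus ?thesis using generator_inv_pos[OF 1, of t] generator_inv_pos[OF 2, of t] t by simp
qed

lemma generator_eq_if_inv_eq:
  assumes 1: "\<psi>1 \<in> generators" and 2: "\<psi>2 \<in> generators"
    and eq: "\<And>t. t \<in> {0<..<1} \<Longrightarrow> generator_inv \<psi>1 t = generator_inv \<psi>2 t" and z: "0 \<le> z"
  shows "\<psi>1 z = \<psi>2 z"
proof -
  have *: "\<phi> z = \<psi> z"
    if \<psi>: "\<psi> \<in> generators" and \<phi>: "\<phi> \<in> generators" and pos: "0 < \<psi> z"
      and eq: "\<And>t. t \<in> {0<..<1} \<Longrightarrow> generator_inv \<psi> t = generator_inv \<phi> t" for \<psi> \<phi>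
  proof (cases "z = 0")
    case False
    hence "\<psi> z \<in> {0<..<1}" using generator_strict[OF \<psi>, of 0 z] generator_0[OF \<psi>] pos z by simp
    hence "generator_inv \<phi> (\<psi> z) = z" "\<phi> (generator_inv \<phi> (\<psi> z)) = \<psi> z"
      using eq generator_inv_eq[OF \<psi> z pos] generator_generator_inv[OF \<phi>, of "\<psi> z"] by auto
    thus ?thesis by simp
  qed (simp add: generator_0[OF \<psi>] generator_0[OF \<phi>])
  have "\<psi>2 z = \<psi>1 z" if "0 < \<psi>1 z" by (rule *[OF 1 2 that eq])
  moreover have "\<psi>1 z = \<psi>2 z" if "0 < \<psi>2 z" by (rule *[OF 2 1 that eq[symmetric]])
  ultimately show ?thesis
    using generator_bounds(1)[OF 1 z] generator_bounds(1)[OF 2 z] by linarith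
qed

lemma archimedean_unique:
  assumes 1: "\<psi>1 \<in> generators" and 2: "\<psi>2 \<in> generators"
    and eq: "\<And>t. t \<in> {0<..<1} \<Longrightarrow> kendall_strict (archimedean \<psi>1) t = kendall_strict (archimedean \<psi>2) t"
  shows "archimedean \<psi>1 = archimedean \<psi>2"
proof -
  have inv: "generator_inv \<psi>1 t = generator_inv \<psi>2 t" if "t \<in> {0<..<1}" for t
  proof (rule generator_inv_unique[OF 1 2 _ that])
    fix t :: real assume t: "t \<in> {0<..<1}"
    show "generator_inv \<psi>1 t * generator_density \<psi>1 (generator_inv \<psi>1 t) =
          generator_inv \<psi>2 t * generator_density \<psi>2 (generator_inv \<psi>2 t)"
      using eq[OF t] kendall_strict_at[OF 1 independence_pickands t] kendall_strict_at[OF 2 independence_pickands t]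
      by (simp add: archimedean_eq_archimax[OF 1] archimedean_eq_archimax[OF 2] kendall_slope_independence)
  qed
  have val: "\<psi>1 z = \<psi>2 z" if "0 \<le> z" for z using generator_eq_if_inv_eq[OF 1 2 inv that] .
  have "generator_ext \<psi>1 = generator_ext \<psi>2"
    using val by (auto simp: generator_ext_def fun_eq_iff)
  thus ?thesis by (simp add: archimedean_def pseudo_inverse_def)
qed

section \<open>Archimax copulas with the Kendall distribution of an Archimedean copula\<close>

theorem lemma6:
  fixes \<psi> A :: "real \<Rightarrow> real" and \<tau>\<^sub>A :: real
  assumes "\<psi> \<in> generators"
    and "A \<in> pickands" and "\<exists>t\<in>{0..1}. A t \<noteq> pickands_M t"
    and "\<tau>\<^sub>A = kendall_tau (extreme_value_copula A)"
  shows "(\<exists>!C. archimedean_copula C \<and>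
            (\<forall>t\<in>{0..1}. kendall_distribution C t = kendall_distribution (archimax_copula \<psi> A) t)) \<and>
         generator_power \<psi> (1 - \<tau>\<^sub>A) \<in> generators \<and>
         archimedean_copula (archimedean (generator_power \<psi> (1 - \<tau>\<^sub>A))) \<and>
         (\<forall>t\<in>{0..1}. kendall_distribution (archimedean (generator_power \<psi> (1 - \<tau>\<^sub>A))) t =
                     kendall_distribution (archimax_copula \<psi> A) t)"
proof -
  note \<psi> = assms(1) and A = assms(2)
  have \<tau>: "1 - \<tau>\<^sub>A = kendall_slope A" by (simp add: assms(4) kendall_tau_extreme_value[OF A])
  have pos: "0 < kendall_slope A" by (rule kendall_slope_pos[OF A assms(3)])
  let ?P = "generator_power \<psi> (1 - \<tau>\<^sub>A)"
  have P: "?P \<in> generators"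
    unfolding \<tau> using pos kendall_slope_bounds[OF A] by (intro generator_power_in_generators[OF \<psi>]) auto
  have iff: "(\<forall>t\<in>{0..1}. kendall_distribution (archimedean \<phi>) t = kendall_distribution (archimax_copula \<psi> A) t) \<longleftrightarrow>
      (\<forall>t\<in>{0<..<1}. kendall_strict (archimedean \<phi>) t = kendall_strict (archimax_copula \<psi> A) t)"
    if \<phi>: "\<phi> \<in> generators" for \<phi>
    unfolding archimedean_eq_archimax[OF \<phi>] by (rule kendall_distribution_eq_iff[OF \<phi> independence_pickands \<psi> A])
  have strict: "kendall_strict (archimedean ?P) t = kendall_strict (archimax_copula \<psi> A) t" if "t \<in> {0<..<1}" for t
    unfolding \<tau> by (rule kendall_strict_generator_power[OF \<psi> A pos that])
  hence same: "\<forall>t\<in>{0..1}. kendall_distribution (archimedean ?P) t = kendall_distribution (archimax_copula \<psi> A) t"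
    using iff[OF P] by blast
  have "\<exists>!C. archimedean_copula C \<and>
      (\<forall>t\<in>{0..1}. kendall_distribution C t = kendall_distribution (archimax_copula \<psi> A) t)"
  proof (rule ex1I[of _ "archimedean ?P"])
    show "archimedean_copula (archimedean ?P) \<and>
      (\<forall>t\<in>{0..1}. kendall_distribution (archimedean ?P) t = kendall_distribution (archimax_copula \<psi> A) t)"
      using archimedean_copulaI[OF P] same by blast
  next
    fix C assume C: "archimedean_copula C \<and>
      (\<forall>t\<in>{0..1}. kendall_distribution C t = kendall_distribution (archimax_copula \<psi> A) t)"
    then obtain \<phi> where \<phi>: "\<phi> \<in> generators" "C = archimedean \<phi>" by (auto simp: archimedean_copula_def)
    hence "\<forall>t\<in>{0<..<1}. kendall_strict (archimedean \<phi>) t = kendall_strict (archimax_copula \<psi> A) t"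
      using C iff by blast
    thus "C = archimedean ?P"
      unfolding \<phi>(2) using strict by (intro archimedean_unique[OF \<phi>(1) P]) simp
  qed
  thus ?thesis using P archimedean_copulaI[OF P] same by blast
qed

end
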